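(* Let $u,v,q$ be complex parameters (generic, so no denominator vanishes). Let $K_8(0)=1$, \[ K_8(1)=\frac{(q-u)(q^2-u)(q-v)(q^2-v)}{(q^3-u)(u-1)(q^3-v)(v-1)}-\frac{(q-1)^4(q+1)^2(q^2+q+1)uv}{q(q^3-u)(u-1)(q^3-v)(v-1)}, \] and $K_8(n):=K(q^3,q^{-n},q^{1-n},q^{2-n},q^{3-n},u,v,q^4)$ for $n\ge2$. Put \[ L_r:=\frac{(q^4u,q^4v,q^7/u,q^7/v;q^4)_r}{(u,v,q^3/u,q^3/v;q^4)_r},\qquad M_r:=\frac{(q^4/u,q^4/v,qu,qv;q^4)_r}{(1/u,1/v,u/q^3,v/q^3;q^4)_r}. \] (i) The sequences with $\alpha_0=\beta_0=1$, $\alpha_{4r-1}=0$ ($r\ge1$), and \[ \alpha_{4r}=L_rq^{8r^2-6r},\quad \alpha_{4r+1}=-L_rq^{8r^2+2r+3}-M_{r+1}q^{8r^2-2r-7}\ (r\ge0),\quad \alpha_{4r-2}=M_rq^{8r^2-10r}\ (r\ge1), \] \[ \beta_n=K_8(n)\frac{(-q^2;q^2)_n}{(q^3;q)_{2n}}, \] form a Bailey pair relative to $a=q^2$. (ii) The sequences with $\alpha_0=\beta_0=1$, $\alpha_{4r-1}=0$ ($r\ge1$), and \[ \alpha_{4r}=L_rq^{8r^2-2r},\quad \alpha_{4r+1}=-L_rq^{8r^2-2r}-M_{r+1}q^{8r^2+2r-6}\ (r\ge0),\quad \alpha_{4r-2}=M_rq^{8r^2-14r}\ (r\ge1), \] \[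 \beta_n=K_8(n)\,q^n\frac{(-q^2;q^2)_n}{(q^3;q)_{2n}}, \] form a Bailey pair relative to $a=q^2$.
   Context: Notation: $(x;q)_n=\prod_{k=0}^{n-1}(1-xq^k)$ and $(x_1,\dots,x_k;q)_n=(x_1;q)_n\cdots(x_k;q)_n$. A pair of sequences $(\alpha_n)_{n\ge0},(\beta_n)_{n\ge0}$ is a Bailey pair relative to $a$ if $\alpha_0=1$ and $\beta_n=\sum_{j=0}^{n}\frac{\alpha_j}{(q;q)_{n-j}(aq;q)_{n+j}}$ for all $n\ge0$. The function $K$: for complex $a,b,c,d,e,u,v$ and a base $p$, let $\sigma_1,\dots,\sigma_4$ be the elementary symmetric functions of $b,c,d,e$ and \[ K(a,b,c,d,e,u,v,p):=\frac{uv(\sigma_3-a\sigma_1)(p\sigma_3-a\sigma_1)a^2+(1-p)uv(a^2-\sigma_4)(a^2-\sigma_2a+\sigma_4)a+(u+v)(a+uv)(\sigma_3-a\sigma_1)(a^2-p\sigma_4)a+(u^2+a)(v^2+a)(a^2-\sigma_4)(a^2-p\sigma_4)}{(a^2-bcde)(a^2-bcde\,p)(1-u)(a-u)(1-v)(a-v)}. \] *)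

theory Defs
  imports Complex_Main
begin

definition qpoch :: "complex \<Rightarrow> complex \<Rightarrow> nat \<Rightarrow> complex" where
  "qpoch x q n = (\<Prod>k<n. 1 - x * q ^ k)"

definition qpochs :: "complex list \<Rightarrow> complex \<Rightarrow> nat \<Rightarrow> complex" where
  "qpochs xs q n = (\<Prod>x\<leftarrow>xs. qpoch x q n)"

text \<open>The base \<open>q\<close>, implicit in the usual notation, is an explicit first argument.\<close>

definition bailey_pair ::
  "complex \<Rightarrow> complex \<Rightarrow> (nat \<Rightarrow> complex) \<Rightarrow> (nat \<Rightarrow> complex) \<Rightarrow> bool" where
  "bailey_pair q a \<alpha> \<beta> \<longleftrightarrow>
     \<alpha> 0 = 1 \<and>
     (\<forall>n. \<beta> n = (\<Sum>j=0..n. \<alpha> j / (qpoch q q (n - j) * qpoch (a * q) q (n + j))))"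

definition K :: "complex \<Rightarrow> complex \<Rightarrow> complex \<Rightarrow> complex \<Rightarrow> complex \<Rightarrow>
    complex \<Rightarrow> complex \<Rightarrow> complex \<Rightarrow> complex" where
  "K a b c d e u v p =
    (let \<sigma>1 = b + c + d + e;
         \<sigma>2 = b*c + b*d + b*e + c*d + c*e + d*e;
         \<sigma>3 = b*c*d + b*c*e + b*d*e + c*d*e;
         \<sigma>4 = b*c*d*e
     in (u*v * (\<sigma>3 - a*\<sigma>1) * (p*\<sigma>3 - a*\<sigma>1) * a^2
         + (1 - p) * u*v * (a^2 - \<sigma>4) * (a^2 - \<sigma>2*a + \<sigma>4) * a
         + (u + v) * (a + u*v) * (\<sigma>3 - a*\<sigma>1) * (a^2 - p*\<sigma>4) * a
         + (u^2 + a) * (v^2 + a) * (a^2 - \<sigma>4) * (a^2 - p*\<sigma>4))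
        / ((a^2 - b*c*d*e) * (a^2 - b*c*d*e*p) * (1 - u) * (a - u) * (1 - v) * (a - v)))"

text \<open>At \<open>n = 1\<close> the general formula has the vanishing denominator factor
  \<open>a\<^sup>2 - b c d e p = 0\<close>, hence the separate clause.\<close>

definition K8 :: "complex \<Rightarrow> complex \<Rightarrow> complex \<Rightarrow> nat \<Rightarrow> complex" where
  "K8 u v q n =
    (if n = 0 then 1
     else if n = 1 then
       (q - u) * (q^2 - u) * (q - v) * (q^2 - v)
         / ((q^3 - u) * (u - 1) * (q^3 - v) * (v - 1))
       - (q - 1)^4 * (q + 1)^2 * (q^2 + q + 1) * u * v
         / (q * (q^3 - u) * (u - 1) * (q^3 - v) * (v - 1))
     else K (q^3) (q powi (- int n)) (q powi (1 - int n)) (q powi (2 - int n))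
            (q powi (3 - int n)) u v (q^4))"

definition L :: "complex \<Rightarrow> complex \<Rightarrow> complex \<Rightarrow> nat \<Rightarrow> complex" where
  "L u v q r = qpochs [q^4 * u, q^4 * v, q^7 / u, q^7 / v] (q^4) r
             / qpochs [u, v, q^3 / u, q^3 / v] (q^4) r"

definition M :: "complex \<Rightarrow> complex \<Rightarrow> complex \<Rightarrow> nat \<Rightarrow> complex" where
  "M u v q r = qpochs [q^4 / u, q^4 / v, q * u, q * v] (q^4) r
             / qpochs [1 / u, 1 / v, u / q^3, v / q^3] (q^4) r"

end

theory Submission
  imports Defs
begin

text \<open>
  The products in \<open>L\<^sub>r\<close> and \<open>M\<^sub>r\<close> telescope, and \<open>M\<^sub>r\<close> is \<open>L\<close> at \<open>-r\<close> up to a power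
  of \<open>q\<close>. With \<open>Y\<^sub>m = q\<^bsup>-m\<^esup> + q\<^bsup>m+3\<^esup>\<close>, \<open>A = u + q\<^sup>3/u\<close>, \<open>B = v + q\<^sup>3/v\<close>, both are, up to a power
  of \<open>q\<close>, the quotient of \<open>(Y\<^sub>m - A)(Y\<^sub>m - B)\<close> by its value at \<open>m = 0\<close>, at \<open>m = 4r\<close> and
  \<open>m = 4r - 3\<close> respectively. Summation by parts then turns both Bailey sums (up to \<open>q\<^sup>n\<close>) into the single sum
  of \<open>w\<^sub>m (1 - q\<^bsup>2m+3\<^esup>) (Y\<^sub>m - A)(Y\<^sub>m - B) / ((q;q)\<^bsub>n-m\<^esub> (q;q)\<^bsub>n+m+3\<^esub>)\<close>, where
  \<open>w\<^sub>m = \<plusminus>q\<^bsup>m(m+1)/2\<^esup>\<close> is supported on \<open>m \<equiv> 0, 1\<close> modulo 4.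

  Without the \<open>Y\<close>-factors this sum is a bilateral sum folded along \<open>m \<mapsto> -3 - m\<close>, and
  the \<open>q\<close>-binomial theorem at the fourth roots of unity evaluates it to
  \<open>(-q\<^sup>2;q\<^sup>2)\<^sub>n / (q;q)\<^bsub>2n+2\<^esub>\<close>. A factor \<open>Y\<^sub>m\<close> is absorbed through
  \<open>q\<^sup>n Y\<^sub>m = 1 + q\<^bsup>2n+3\<^esup> - (1 - q\<^bsup>n-m\<^esup>)(1 - q\<^bsup>n+m+3\<^esup>)\<close>, which relates the sum to those at
  \<open>n\<close> and \<open>n - 1\<close> with one factor less; what remains is a rational identity for \<open>K\<close>.
\<close>

subsection \<open>\<open>q\<close>-Pochhammer symbols and powers\<close>

lemma qpoch_0 [simp]: "qpoch x p 0 = 1"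
  by (simp add: qpoch_def)

lemma qpoch_Suc: "qpoch x p (Suc n) = qpoch x p n * (1 - x * p ^ n)"
  by (simp add: qpoch_def)

lemma qpoch_Suc_shift: "qpoch x p (Suc n) = (1 - x) * qpoch (x * p) p n"
  by (simp add: qpoch_def prod.lessThan_Suc_shift mult.assoc del: prod.lessThan_Suc)

lemma qpoch_telescope: "(1 - x) * qpoch (x * p) p r = qpoch x p r * (1 - x * p ^ r)"
  by (metis qpoch_Suc qpoch_Suc_shift)

text \<open>Multiplying the argument by the base removes the first factor and adds one at the end,
  so everything between cancels. With base \<open>q^4\<close> this collapses the quotients in
  \<open>L\<close> and \<open>M\<close>.\<close>

lemma qpoch_ratio:
  assumes "x \<noteq> 1" "qpoch x p r \<noteq> 0"
  shows "qpoch (x * p) p r / qpoch x p r = (1 - x * p ^ r) / (1 - x)"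
  using assms qpoch_telescope[of x p r] by (simp add: frac_eq_eq mult_ac)

lemma two_mult_choose_two: "2 * (Suc k choose 2) = k * Suc k"
  by (induction k) (simp_all add: numeral_2_eq_2)

lemma choose_two_shift: "(m + n choose 2) = (m choose 2) + (n choose 2) + m * n"
  by (induction m) (simp_all add: numeral_2_eq_2)

lemma power_split: "m = k + l \<Longrightarrow> x ^ m = x ^ k * x ^ l" for x :: "'a :: monoid_mult"
  by (simp add: power_add)

text \<open>The integer exponents attached to \<open>L\<close> and \<open>M\<close> can be negative,
  as in \<open>8 * r^2 - 2 * r - 7\<close> at \<open>r = 0\<close>. The power of \<open>q\<close>
  split off from \<open>L\<close> or \<open>M\<close> makes them natural, and the rest of the
  argument uses natural powers only.\<close>

lemma power_int_mult_power:
  fixes x :: complex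
  assumes "x \<noteq> 0" "e + int k = int l"
  shows "x powi e * x ^ k = x ^ l"
proof -
  have "x powi e * x ^ k = x powi (e + int k)"
    using assms(1) by (simp add: power_int_add)
  then show ?thesis
    by (simp add: assms(2))
qed

subsection \<open>The sign pattern modulo 4\<close>

definition chi :: "nat \<Rightarrow> complex" where
  "chi m = (if m mod 4 = 0 then 1 else if m mod 4 = 1 then - 1 else 0)"

lemma chi_add_4_mult [simp]: "chi (m + 4 * k) = chi m" "chi (4 * k + m) = chi m"
  by (simp_all add: chi_def)

text \<open>Fourier expansion on the residues modulo 4. The four values of \<open>chi\<close> add up
  to 0, so the trivial root 1 does not occur.\<close>

lemma chi_eq_root_sum:
  "chi m = (- 1) ^ m / 2 + (1 + \<i>) / 4 * \<i> ^ m + (1 - \<i>) / 4 * (- \<i>) ^ m"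
proof -
  obtain k r where m: "m = 4 * k + r" "r < 4"
    by (metis mod_less_divisor mult_div_mod_eq zero_less_numeral)
  have r: "r = 0 \<or> r = 1 \<or> r = 2 \<or> r = 3"
    using m(2) by auto
  have 1: "\<i> ^ 4 = 1" "(- \<i>) ^ 4 = 1" "(- 1 :: complex) ^ 4 = 1" "\<i> ^ 3 = - \<i>"
    by (simp_all add: power4_eq_xxxx power3_eq_cube)
  have "\<i> ^ m = \<i> ^ r" "(- \<i>) ^ m = (- \<i>) ^ r" "(- 1 :: complex) ^ m = (- 1) ^ r"
    unfolding m(1) power_add power_mult 1 by simp_all
  moreover have "chi m = chi r"
    by (simp add: m)
  ultimately show ?thesis
    using r by (auto simp: chi_def 1 field_simps)
qed

text \<open>Modulo 4 the argument is \<open>-3 - m\<close>, written with natural numbers: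
  \<open>chi\<close> is odd under the folding \<open>m -> -3 - m\<close>. In the proof
  \<open>3 * m + 9\<close> represents the same class.\<close>

lemma chi_reflect: "m \<le> n \<Longrightarrow> chi (n - m + 3 * n + 9) = - chi m"
proof -
  assume "m \<le> n"
  then obtain p where n: "n = m + p"
    using le_Suc_ex by blast
  have "n - m + 3 * n + 9 = 4 * p + (3 * m + 9)"
    by (simp add: n)
  then have "chi (n - m + 3 * n + 9) = chi (3 * m + 9)"
    by (simp only: chi_add_4_mult)
  also have "\<dots> = - chi m"
  proof -
    obtain k r where m: "m = 4 * k + r" "r < 4"
      by (metis mod_less_divisor mult_div_mod_eq zero_less_numeral)
    have "3 * m + 9 = 4 * (3 * k) + (3 * r + 9)"
      by (simp add: m)
    then have "chi (3 * m + 9) = chi (3 * r + 9)" "chi m = chi r"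
      using m by (simp_all only: chi_add_4_mult)
    moreover have "r = 0 \<or> r = 1 \<or> r = 2 \<or> r = 3"
      using m(2) by auto
    ultimately show ?thesis
      by (auto simp: chi_def)
  qed
  finally show ?thesis .
qed

text \<open>The second assumption amounts to saying that no positive power of \<open>q\<close>
  equals 1.\<close>

locale q_generic =
  fixes q :: complex
  assumes q_nonzero: "q \<noteq> 0" and qpoch_nonzero: "\<And>n. qpoch q q n \<noteq> 0"
begin

lemma q_power_neq_1: "n > 0 \<Longrightarrow> q ^ n \<noteq> 1"
  using qpoch_nonzero[of n] by (cases n) (auto simp: qpoch_Suc)

lemma one_plus_q_power_nonzero: "1 + q ^ n \<noteq> 0"
proof
  assume "1 + q ^ n = 0"
  moreover from this have "n > 0"
    by (cases n) auto
  moreover have "(1 - q ^ n) * (1 + q ^ n) = 1 - q ^ (n * 2)"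
    by (simp add: algebra_simps power_mult power2_eq_square)
  ultimately show False
    using q_power_neq_1[of "n * 2"] by simp
qed

lemma qpoch_q_add_2: "qpoch q q (n + 2) = (1 - q) * (1 - q\<^sup>2) * qpoch (q\<^sup>2 * q) q n"
  by (simp add: qpoch_Suc_shift power2_eq_square)

lemma inverse_qpoch_pred:
  assumes "n > 0"
  shows "1 / qpoch q q (n - 1) = (1 - q ^ n) / qpoch q q n"
  using assms qpoch_nonzero[of n] by (cases n) (auto simp: qpoch_Suc)

subsection \<open>The \<open>q\<close>-binomial theorem at fourth roots of unity\<close>

text \<open>The finite q-binomial theorem, divided by \<open>qpoch q q N\<close> so that no Gaussian
  binomial coefficients have to be introduced.\<close>

lemma q_binomial:
  "(\<Sum>k\<le>N. z ^ k * q ^ (k choose 2) / (qpoch q q k * qpoch q q (N - k))) = qpoch (- z) q N / qpoch q q N"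
proof (induction N)
  case 0
  then show ?case by (simp add: numeral_2_eq_2)
next
  case (Suc N)
  define s where "s N k = z ^ k * q ^ (k choose 2) / (qpoch q q k * qpoch q q (N - k))" for N k
  have low: "(1 - q ^ (Suc N - k)) * s (Suc N) k = s N k" if "k \<le> N" for k
    using that qpoch_nonzero[of "Suc (N - k)"]
    by (auto simp: s_def Suc_diff_le qpoch_Suc)
  have high: "q ^ (N - k) * (1 - q ^ Suc k) * s (Suc N) (Suc k) = z * q ^ N * s N k" if "k \<le> N" for k
  proof -
    have "q ^ N = q ^ (N - k) * q ^ k"
      using that by (simp flip: power_add)
    then show ?thesis
      using qpoch_nonzero[of "Suc k"] qpoch_nonzero[of "N - k"]
      by (auto simp: s_def qpoch_Suc numeral_2_eq_2 power_add divide_simps)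
  qed
  \<comment> \<open>This is the q-Pascal splitting
    \<open>1 - q^(N+1) = (1 - q^(N+1-k)) + q^(N+1-k) * (1 - q^k)\<close>. The first part kills
    \<open>k = N + 1\<close> and the second kills \<open>k = 0\<close>; \<open>low\<close> and
    \<open>high\<close> reduce both to the sum for \<open>N\<close>.\<close>
  have "(1 - q ^ Suc N) * (\<Sum>k\<le>Suc N. s (Suc N) k) =
      (\<Sum>k\<le>Suc N. (1 - q ^ (Suc N - k)) * s (Suc N) k) +
      (\<Sum>k\<le>Suc N. q ^ (Suc N - k) * (1 - q ^ k) * s (Suc N) k)"
    unfolding sum_distrib_left sum.distrib[symmetric]
    by (intro sum.cong refl) (auto simp: algebra_simps simp flip: power_add power_Suc)
  also have "(\<Sum>k\<le>Suc N. (1 - q ^ (Suc N - k)) * s (Suc N) k) = (\<Sum>k\<le>N. s N k)"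
    by (simp add: low)
  also have "(\<Sum>k\<le>Suc N. q ^ (Suc N - k) * (1 - q ^ k) * s (Suc N) k) = z * q ^ N * (\<Sum>k\<le>N. s N k)"
    unfolding sum.atMost_Suc_shift sum_distrib_left
    using high by (simp del: power_Suc)
  finally have "(1 - q ^ Suc N) * (\<Sum>k\<le>Suc N. s (Suc N) k) = (1 + z * q ^ N) * (\<Sum>k\<le>N. s N k)"
    by (simp only: distrib_right mult_1)
  moreover have "(\<Sum>k\<le>N. s N k) = qpoch (- z) q N / qpoch q q N"
    using Suc by (simp add: s_def)
  ultimately show ?case
    using qpoch_nonzero[of "Suc N"]
    by (simp add: s_def[symmetric] qpoch_Suc nonzero_eq_divide_eq del: sum.atMost_Suc)
      (simp add: mult_ac del: sum.atMost_Suc)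
qed

text \<open>The factors are \<open>1 + z * q^j\<close> for \<open>j\<close> from
  \<open>-n - 2\<close> to \<open>n\<close>, and the power of \<open>q\<close> in front clears the
  negative exponents. As \<open>z^2 = -1\<close>, the factors at \<open>j\<close> and
  \<open>-j\<close> combine to \<open>z * (1 + q^(2j))\<close> for \<open>j = 1, ..., n\<close>; the
  factors at \<open>0\<close>, \<open>-n - 1\<close> and \<open>-n - 2\<close> have no
  partner.\<close>

lemma qpoch_sqrt_minus_one:
  assumes "z\<^sup>2 = - 1"
  shows "q ^ (n + 3 choose 2) * qpoch (- (z / q ^ (n + 2))) q (2 * n + 3) =
    z ^ n * (1 + z) * (q ^ (n + 1) + z) * (q ^ (n + 2) + z) * qpoch (- (q\<^sup>2)) (q\<^sup>2) n"
proof (induction n)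
  case 0
  have "(3 choose 2) = (3::nat)"
    by (simp add: numeral_2_eq_2 numeral_3_eq_3)
  then show ?case
    using q_nonzero by (simp add: numeral_3_eq_3 qpoch_Suc divide_simps power2_eq_square)
next
  case (Suc n)
  have c: "q ^ (Suc n + 3 choose 2) = q ^ (n + 3) * q ^ (n + 3 choose 2)"
    using choose_two_shift[of 1 "n + 3"] by (simp add: power_add[symmetric] add_ac numeral_2_eq_2)
  \<comment> \<open>The product grows at both ends, by the exponents \<open>-(n + 3)\<close> and
    \<open>n + 1\<close>.\<close>
  have "qpoch (- (z / q ^ (Suc n + 2))) q (2 * Suc n + 3) =
      (1 + z / q ^ (n + 3)) * qpoch (- (z / q ^ (n + 2))) q (2 * n + 3) * (1 + z * q ^ (n + 1))"
  proof -
    have "2 * Suc n + 3 = Suc (Suc (2 * n + 3))"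
      by simp
    moreover have "q ^ (Suc n + 2) = q ^ (n + 2) * q"
      by simp
    then have "- (z / q ^ (Suc n + 2)) * q = - (z / q ^ (n + 2))"
      using q_nonzero by (simp del: power_Suc)
    moreover have "q ^ (2 * n + 3) = q ^ (n + 2) * q ^ (n + 1)"
      by (rule power_split) simp
    moreover have cancel: "- (z / x) * (x * y) = - (z * y)" if "x \<noteq> 0" for x y
      using that by simp
    have "- (z / q ^ (n + 2)) * (q ^ (n + 2) * q ^ (n + 1)) = - (z * q ^ (n + 1))"
      by (rule cancel) (simp add: q_nonzero)
    moreover have "Suc n + 2 = n + 3"
      by simp
    moreover have "qpoch y q (Suc (Suc N)) = (1 - y) * qpoch (y * q) q N * (1 - y * q * q ^ N)" for y N
      by (subst qpoch_Suc_shift, subst qpoch_Suc) (simp only: mult.assoc)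
    ultimately show ?thesis
      by (simp only: diff_minus_eq_add)
  qed
  then have "q ^ (Suc n + 3 choose 2) * qpoch (- (z / q ^ (Suc n + 2))) q (2 * Suc n + 3) =
      (q ^ (n + 3) * (1 + z / q ^ (n + 3))) * (1 + z * q ^ (n + 1)) *
      (q ^ (n + 3 choose 2) * qpoch (- (z / q ^ (n + 2))) q (2 * n + 3))"
    unfolding c by (simp only: mult_ac)
  also have "q ^ (n + 3) * (1 + z / q ^ (n + 3)) = q ^ (n + 3) + z"
    using q_nonzero by (simp add: distrib_left del: power_Suc)
  also have "(q ^ (n + 3) + z) * (1 + z * q ^ (n + 1)) *
      (q ^ (n + 3 choose 2) * qpoch (- (z / q ^ (n + 2))) q (2 * n + 3)) =
      (q ^ (n + 3) + z) * z ^ n * (1 + z) * ((1 + z * q ^ (n + 1)) * (q ^ (n + 1) + z)) * (q ^ (n + 2) + z) * qpoch (- (q\<^sup>2)) (q\<^sup>2) n"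
    unfolding Suc by (simp only: mult_ac)
  \<comment> \<open>The new factor at \<open>n + 1\<close> meets the formerly unpaired one at
    \<open>-(n + 1)\<close>.\<close>
  also have "(1 + z * q ^ (n + 1)) * (q ^ (n + 1) + z) = z * (1 + q\<^sup>2 * (q\<^sup>2) ^ n)"
  proof -
    have "(1 + z * x) * (x + z) = z * (1 + x\<^sup>2) + (1 + z\<^sup>2) * x" for x
      by (simp add: algebra_simps power2_eq_square)
    moreover have "(q ^ (n + 1))\<^sup>2 = q\<^sup>2 * (q\<^sup>2) ^ n"
      by (simp add: power_mult_distrib power_mult[symmetric] mult.commute)
    ultimately show ?thesis
      using assms by (simp only:) simp
  qed
  finally have "q ^ (Suc n + 3 choose 2) * qpoch (- (z / q ^ (Suc n + 2))) q (2 * Suc n + 3) =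
      (q ^ (n + 3) + z) * z ^ n * (1 + z) * (z * (1 + q\<^sup>2 * (q\<^sup>2) ^ n)) * (q ^ (n + 2) + z) * qpoch (- (q\<^sup>2)) (q\<^sup>2) n" .
  moreover have "Suc n + 1 = n + 2" "Suc n + 2 = n + 3"
    by simp_all
  ultimately show ?case
    by (simp only: qpoch_Suc power_Suc mult_ac mult_minus_left diff_minus_eq_add)
qed

text \<open>Up to a constant factor these are the Bailey sums relative to \<open>a = q\<^sup>3\<close>: \<open>(q;q)\<^bsub>n+m+3\<^esub>\<close> is a constant times
  \<open>(q\<^sup>4;q)\<^bsub>n+m\<^esub>\<close>.\<close>

definition bsum :: "(nat \<Rightarrow> complex) \<Rightarrow> nat \<Rightarrow> complex" where
  "bsum g n = (\<Sum>m\<le>n. g m / (qpoch q q (n - m) * qpoch q q (n + m + 3)))"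

definition wt :: "nat \<Rightarrow> complex" where
  "wt m = chi m * q ^ (Suc m choose 2)"

section \<open>Evaluation of the weighted sum without factors \<open>Y\<close>\<close>

text \<open>The power \<open>z ^ (3 * n + 9)\<close> is what the shift in
  \<open>chi (k + 3 * n + 9)\<close> contributes to the Fourier component of \<open>z\<close>.
  Together with the \<open>z ^ n\<close> of the product it collapses to \<open>z\<close>, since
  \<open>z^4 = 1\<close>.\<close>

lemma q_binomial_at_root:
  assumes "z\<^sup>2 = - 1"
  shows "q ^ (n + 3 choose 2) * z ^ (3 * n + 9) *
      (\<Sum>k\<le>2 * n + 3. (z / q ^ (n + 2)) ^ k * q ^ (k choose 2) / (qpoch q q k * qpoch q q (2 * n + 3 - k))) =
    z * (1 + z) * (q ^ (n + 1) + z) * (q ^ (n + 2) + z) * qpoch (- (q\<^sup>2)) (q\<^sup>2) n / qpoch q q (2 * n + 3)"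
proof -
  have "z ^ (3 * n + 9) * z ^ n = (z\<^sup>2) ^ (2 * n + 4) * z"
    by (simp only: power_mult[symmetric] power_add[symmetric] power_Suc2[symmetric]) (simp add: algebra_simps)
  then have z: "z ^ (3 * n + 9) * z ^ n = z"
    using assms by simp
  have "q ^ (n + 3 choose 2) * z ^ (3 * n + 9) *
      (\<Sum>k\<le>2 * n + 3. (z / q ^ (n + 2)) ^ k * q ^ (k choose 2) / (qpoch q q k * qpoch q q (2 * n + 3 - k))) =
    z ^ (3 * n + 9) * (q ^ (n + 3 choose 2) * qpoch (- (z / q ^ (n + 2))) q (2 * n + 3)) / qpoch q q (2 * n + 3)"
    unfolding q_binomial by (simp only: mult_ac times_divide_eq_right)
  also have "\<dots> = (z ^ (3 * n + 9) * z ^ n) * (1 + z) * (q ^ (n + 1) + z) * (q ^ (n + 2) + z) * qpoch (- (q\<^sup>2)) (q\<^sup>2) n / qpoch q q (2 * n + 3)"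
    unfolding qpoch_sqrt_minus_one[OF assms] by (simp only: mult_ac)
  finally show ?thesis
    unfolding z .
qed

text \<open>The product contains the factor of index \<open>n + 2\<close>, which is
  \<open>1 - q^(n+2) / q^(n+2)\<close>. The Fourier component of \<open>-1\<close> therefore drops
  out.\<close>

lemma q_binomial_at_minus_one:
  "(\<Sum>k\<le>2 * n + 3. (- 1 / q ^ (n + 2)) ^ k * q ^ (k choose 2) / (qpoch q q k * qpoch q q (2 * n + 3 - k))) = 0"
proof -
  have "qpoch (- (- 1 / q ^ (n + 2))) q (2 * n + 3) = 0"
    unfolding qpoch_def using q_nonzero
    by (intro prod_zero) (auto intro!: bexI[of _ "n + 2"])
  then show ?thesis
    unfolding q_binomial by simp
qed

text \<open>Here \<open>k = n + 3 + m\<close> runs over the bilateral range \<open>-n - 3 \<le> m \<le> n\<close>; the shift \<open>3n + 9\<close>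
  is congruent to \<open>-(n + 3)\<close> modulo 4. The terms at \<open>m\<close> and \<open>-3 - m\<close> are paired, and those at
  \<open>m = -1, -2\<close> vanish.\<close>

lemma bsum_wt_full:
  "bsum (\<lambda>m. wt m * (1 - q ^ (2 * m + 3))) n =
    q ^ (n + 3 choose 2) * (\<Sum>k\<le>2 * n + 3. chi (k + 3 * n + 9) *
      ((1 / q ^ (n + 2)) ^ k * q ^ (k choose 2) / (qpoch q q k * qpoch q q (2 * n + 3 - k))))"
proof -
  define s where "s k = q ^ (n + 3 choose 2) * (chi (k + 3 * n + 9) *
      ((1 / q ^ (n + 2)) ^ k * q ^ (k choose 2) / (qpoch q q k * qpoch q q (2 * n + 3 - k))))" for k
  have up: "s (m + (n + 3)) = wt m / (qpoch q q (n - m) * qpoch q q (n + m + 3))" for m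
  proof -
    \<comment> \<open>Exponents are compared after doubling, which removes the halves from the
      binomial coefficients.\<close>
    have e: "(n + 3 choose 2) + (m + (n + 3) choose 2) = (n + 2) * (m + (n + 3)) + (Suc m choose 2)"
    proof -
      have "2 * ((n + 3 choose 2) + (m + (n + 3) choose 2)) = 2 * ((n + 2) * (m + (n + 3)) + (Suc m choose 2))"
        using two_mult_choose_two[of "n + 2"] two_mult_choose_two[of "m + n + 2"] two_mult_choose_two[of m]
        by (simp add: algebra_simps eval_nat_numeral)
      then show ?thesis by simp
    qed
    have q: "q ^ (n + 3 choose 2) * q ^ (m + (n + 3) choose 2) = (q ^ (n + 2)) ^ (m + (n + 3)) * q ^ (Suc m choose 2)"
      by (simp only: power_add[symmetric] power_mult[symmetric] e)
    have c: "chi (m + (n + 3) + 3 * n + 9) = chi m"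
    proof -
      have "m + (n + 3) + 3 * n + 9 = m + 4 * (n + 3)"
        by simp
      then show ?thesis by (simp only: chi_add_4_mult)
    qed
    have "s (m + (n + 3)) = chi m * (q ^ (n + 3 choose 2) * q ^ (m + (n + 3) choose 2)) / (q ^ (n + 2)) ^ (m + (n + 3))
        / (qpoch q q (m + (n + 3)) * qpoch q q (2 * n + 3 - (m + (n + 3))))"
      unfolding s_def c by (simp add: power_divide)
    also have "\<dots> = wt m / (qpoch q q (m + (n + 3)) * qpoch q q (2 * n + 3 - (m + (n + 3))))"
      unfolding q wt_def using q_nonzero by simp
    also have "2 * n + 3 - (m + (n + 3)) = n - m"
      by simp
    finally show ?thesis
      by (simp add: mult.commute add_ac)
  qed
  \<comment> \<open>Index \<open>n - m\<close> is the bilateral index \<open>-3 - m\<close>. The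
    reflection flips the sign of \<open>chi\<close> and raises the exponent by
    \<open>2 * m + 3\<close>, which is where the factor \<open>1 - q ^ (2 * m + 3)\<close> comes
    from.\<close>
  have down: "s (n - m) = - wt m * q ^ (2 * m + 3) / (qpoch q q (n - m) * qpoch q q (n + m + 3))" if mn: "m \<le> n" for m
  proof -
    obtain p where n: "n = m + p"
      using le_Suc_ex[OF mn] by blast
    have e: "(n + 3 choose 2) + (n - m choose 2) = (n + 2) * (n - m) + (Suc m choose 2) + (2 * m + 3)"
    proof -
      have p: "2 * (p choose 2) + p = p * p"
        using two_mult_choose_two[of "p - 1"] by (cases p) simp_all
      \<comment> \<open>Adding \<open>p\<close> on both sides avoids a subtraction:
        \<open>2 * (p choose 2)\<close> is \<open>p * p - p\<close>.\<close>
      have "2 * ((n + 3 choose 2) + (n - m choose 2)) + p = 2 * ((n + 2) * (n - m) + (Suc m choose 2) + (2 * m + 3)) + p"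
        using two_mult_choose_two[of "n + 2"] p two_mult_choose_two[of m]
        by (simp add: n algebra_simps eval_nat_numeral)
      then show ?thesis by simp
    qed
    have q: "q ^ (n + 3 choose 2) * q ^ (n - m choose 2) = (q ^ (n + 2)) ^ (n - m) * (q ^ (Suc m choose 2) * q ^ (2 * m + 3))"
      by (simp only: power_add[symmetric] power_mult[symmetric] e add.assoc)
    have "s (n - m) = - chi m * (q ^ (n + 3 choose 2) * q ^ (n - m choose 2)) / (q ^ (n + 2)) ^ (n - m)
        / (qpoch q q (n - m) * qpoch q q (2 * n + 3 - (n - m)))"
      unfolding s_def chi_reflect[OF mn] by (simp add: power_divide)
    also have "\<dots> = - wt m * q ^ (2 * m + 3) / (qpoch q q (n - m) * qpoch q q (2 * n + 3 - (n - m)))"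
      unfolding q wt_def using q_nonzero by (simp add: mult.assoc)
    also have "2 * n + 3 - (n - m) = n + m + 3"
      using mn by simp
    finally show ?thesis .
  qed
  have mid: "s (n + 1) = 0" "s (n + 2) = 0"
  proof -
    have "n + 1 + 3 * n + 9 = 4 * (n + 2) + 2" "n + 2 + 3 * n + 9 = 4 * (n + 2) + 3"
      by simp_all
    then show "s (n + 1) = 0" "s (n + 2) = 0"
      unfolding s_def by (simp_all only: chi_add_4_mult) (simp_all add: chi_def)
  qed
  have "(\<Sum>k\<le>2 * n + 3. s k) = (\<Sum>k<n + 3. s k) + (\<Sum>k<n + 1. s (k + (n + 3)))"
  proof -
    have "{..2 * n + 3} = {..<(n + 1) + (n + 3)}"
      by auto
    moreover have "(\<Sum>k<a + b. s k) = (\<Sum>k<b. s k) + (\<Sum>k<a. s (k + b))" for a b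
      by (induction a) (simp_all add: ac_simps)
    ultimately show ?thesis
      by (simp only:)
  qed
  also have "(\<Sum>k<n + 3. s k) = (\<Sum>k\<le>n. s k)"
    using mid by (simp add: numeral_3_eq_3 lessThan_Suc_atMost)
  also have "\<dots> = (\<Sum>m\<le>n. s (n - m))"
    by (rule sum.nat_diff_reindex[symmetric, of s "Suc n", unfolded lessThan_Suc_atMost, simplified])
  also have "(\<Sum>k<n + 1. s (k + (n + 3))) = (\<Sum>k\<le>n. s (k + (n + 3)))"
    by (simp add: lessThan_Suc_atMost)
  also have "(\<Sum>m\<le>n. s (n - m)) + (\<Sum>k\<le>n. s (k + (n + 3))) = bsum (\<lambda>m. wt m * (1 - q ^ (2 * m + 3))) n"
    unfolding bsum_def sum.distrib[symmetric]
  proof (intro sum.cong refl)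
    fix m assume "m \<in> {..n}"
    then have "s (n - m) + s (m + (n + 3)) =
        - wt m * q ^ (2 * m + 3) / (qpoch q q (n - m) * qpoch q q (n + m + 3)) + wt m / (qpoch q q (n - m) * qpoch q q (n + m + 3))"
      by (simp only: up down atMost_iff)
    also have "\<dots> = wt m * (1 - q ^ (2 * m + 3)) / (qpoch q q (n - m) * qpoch q q (n + m + 3))"
      unfolding add_divide_distrib[symmetric] by (simp add: right_diff_distrib)
    finally show "s (n - m) + s (m + (n + 3)) = wt m * (1 - q ^ (2 * m + 3)) / (qpoch q q (n - m) * qpoch q q (n + m + 3))" .
  qed
  finally show ?thesis
    unfolding s_def sum_distrib_left by simp
qed

text \<open>Expanding \<open>chi\<close> over the roots leaves only the components at
  \<open>\<i>\<close> and \<open>-\<i>\<close>. Their sum carries the factor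
  \<open>1 - q ^ (2 * n + 3)\<close>, which cancels the last factor of
  \<open>qpoch q q (2 * n + 3)\<close>.\<close>

lemma bsum_wt:
  "bsum (\<lambda>m. wt m * (1 - q ^ (2 * m + 3))) n = qpoch (- (q\<^sup>2)) (q\<^sup>2) n / qpoch q q (2 * n + 2)"
proof -
  define G where "G z = (\<Sum>k\<le>2 * n + 3. (z / q ^ (n + 2)) ^ k * q ^ (k choose 2) / (qpoch q q k * qpoch q q (2 * n + 3 - k)))" for z
  define C where "C = q ^ (n + 3 choose 2)"
  define D where "D = qpoch (- (q\<^sup>2)) (q\<^sup>2) n / qpoch q q (2 * n + 3)"
  have root: "C * z ^ (3 * n + 9) * G z = z * (1 + z) * (q ^ (n + 1) + z) * (q ^ (n + 2) + z) * D" if "z\<^sup>2 = - 1" for z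
    using q_binomial_at_root[OF that, of n] by (simp add: G_def C_def D_def)
  have "G (- 1) = 0"
    unfolding G_def by (rule q_binomial_at_minus_one)
  have "(\<Sum>k\<le>2 * n + 3. chi (k + 3 * n + 9) *
      ((1 / q ^ (n + 2)) ^ k * q ^ (k choose 2) / (qpoch q q k * qpoch q q (2 * n + 3 - k)))) =
     (- 1) ^ (3 * n + 9) / 2 * G (- 1) + (1 + \<i>) / 4 * \<i> ^ (3 * n + 9) * G \<i> + (1 - \<i>) / 4 * (- \<i>) ^ (3 * n + 9) * G (- \<i>)"
  proof -
    define x where "x = 1 / q ^ (n + 2)"
    have "(z / q ^ (n + 2)) ^ k = z ^ k * x ^ k" for z k
      by (simp add: power_divide x_def)
    moreover have "(p1 * m1 / 2 + c * (p2 * m2) + d * (p3 * m3)) * (y * b / e) =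
        m1 / 2 * (p1 * y * b / e) + c * m2 * (p2 * y * b / e) + d * m3 * (p3 * y * b / e)"
      for p1 p2 p3 m1 m2 m3 c d y b e :: complex
      by (simp add: algebra_simps add_divide_distrib)
    ultimately show ?thesis
      unfolding G_def x_def[symmetric] sum_distrib_left sum.distrib[symmetric]
      by (intro sum.cong refl) (simp only: chi_eq_root_sum power_add[of _ _ "3 * n + 9"] add.assoc)
  qed
  then have "bsum (\<lambda>m. wt m * (1 - q ^ (2 * m + 3))) n =
      (1 + \<i>) / 4 * (C * \<i> ^ (3 * n + 9) * G \<i>) + (1 - \<i>) / 4 * (C * (- \<i>) ^ (3 * n + 9) * G (- \<i>))"
    unfolding bsum_wt_full C_def \<open>G (- 1) = 0\<close> by (simp only: distrib_left mult_ac mult_zero_left mult_zero_right add_0)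
  also have "\<dots> = (1 - q ^ (n + 1) * q ^ (n + 2)) * D"
  proof -
    have 1: "\<i> * \<i> = - 1" by simp
    \<comment> \<open>Both \<open>\<i> * (1 + \<i>)^2\<close> and its conjugate equal -2, so only
      the even part \<open>x * y - 1\<close> of \<open>(x + \<i>) * (y + \<i>)\<close>
      survives.\<close>
    have 2: "(1 + \<i>) / 4 * (\<i> * (1 + \<i>) * (x + \<i>) * (y + \<i>) * D) + (1 - \<i>) / 4 * (- \<i> * (1 + - \<i>) * (x + - \<i>) * (y + - \<i>) * D) = (1 - x * y) * D" for x y
      using 1 by (simp add: field_simps)
    have "\<i>\<^sup>2 = - 1" "(- \<i>)\<^sup>2 = - 1"
      by simp_all
    then show ?thesis
      by (simp only: root 2)
  qed
  also have "q ^ (n + 1) * q ^ (n + 2) = q ^ (2 * n + 3)"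
    by (rule power_split[symmetric]) simp
  also have "(1 - q ^ (2 * n + 3)) * D = qpoch (- (q\<^sup>2)) (q\<^sup>2) n / qpoch q q (2 * n + 2)"
    using inverse_qpoch_pred[of "2 * n + 3"] by (simp add: D_def) (metis (no_types, lifting) mult.commute mult.right_neutral times_divide_eq_right)
  finally show ?thesis .
qed

subsection \<open>Insertion of the factors \<open>Y\<close>, and summation by parts\<close>

definition Y :: "nat \<Rightarrow> complex" where
  "Y m = 1 / q ^ m + q ^ (m + 3)"

lemma bsum_cong: "(\<And>m. m \<le> n \<Longrightarrow> f m = g m) \<Longrightarrow> bsum f n = bsum g n"
  by (simp add: bsum_def)

lemma bsum_mult_left: "bsum (\<lambda>m. c * f m) n = c * bsum f n"
  by (simp add: bsum_def sum_distrib_left)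

text \<open>The product \<open>(1 - q^(N-m)) * (1 - q^(N+m+3))\<close> with \<open>N = n + 1\<close>
  cancels the last factors of both Pochhammer symbols in the denominator and so lowers
  \<open>N\<close> to \<open>n\<close>. The term \<open>m = N\<close> disappears because its first
  factor is 0.\<close>

lemma bsum_mult_Y_Suc:
  "q ^ Suc n * bsum (\<lambda>m. g m * Y m) (Suc n) = (1 + q ^ (2 * n + 5)) * bsum g (Suc n) - bsum g n"
proof -
  define d where "d n m = 1 / (qpoch q q (n - m) * qpoch q q (n + m + 3))" for n m
  have Y: "q ^ Suc n * Y m = q ^ (Suc n - m) + q ^ (Suc n + m + 3)" if "m \<le> Suc n" for m
  proof -
    have "q ^ Suc n = q ^ (Suc n - m) * q ^ m" "q ^ (Suc n + m + 3) = q ^ Suc n * q ^ (m + 3)"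
      using that by (auto intro: power_split simp del: power_Suc)
    then show ?thesis
      using q_nonzero by (simp add: Y_def distrib_left del: power_Suc)
  qed
  have q: "q ^ (2 * n + 5) = q ^ (Suc n - m) * q ^ (Suc n + m + 3)" if "m \<le> Suc n" for m
    using that by (intro power_split) simp
  have d: "d n m = (1 - q ^ (Suc n - m)) * (1 - q ^ (Suc n + m + 3)) * d (Suc n) m" if "m \<le> n" for m
  proof -
    have "d n m = (1 / qpoch q q (Suc n - m - 1)) * (1 / qpoch q q (Suc n + m + 3 - 1))"
      by (simp add: d_def add_ac)
    also have "\<dots> = (1 - q ^ (Suc n - m)) / qpoch q q (Suc n - m) * ((1 - q ^ (Suc n + m + 3)) / qpoch q q (Suc n + m + 3))"
      using that inverse_qpoch_pred[of "Suc n - m"] inverse_qpoch_pred[of "Suc n + m + 3"] by simp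
    finally show ?thesis
      by (simp add: d_def)
  qed
  have "q ^ Suc n * bsum (\<lambda>m. g m * Y m) (Suc n) = (\<Sum>m\<le>Suc n. (q ^ Suc n * Y m) * (g m * d (Suc n) m))"
    unfolding bsum_def d_def sum_distrib_left by (intro sum.cong refl) (simp del: power_Suc)
  also have "\<dots> = (\<Sum>m\<le>Suc n. (1 + q ^ (2 * n + 5)) * (g m * d (Suc n) m)
       - (1 - q ^ (Suc n - m)) * (1 - q ^ (Suc n + m + 3)) * (g m * d (Suc n) m))"
  proof (intro sum.cong refl)
    fix m assume "m \<in> {..Suc n}"
    then have m: "m \<le> Suc n" by simp
    show "(q ^ Suc n * Y m) * (g m * d (Suc n) m) = (1 + q ^ (2 * n + 5)) * (g m * d (Suc n) m)
       - (1 - q ^ (Suc n - m)) * (1 - q ^ (Suc n + m + 3)) * (g m * d (Suc n) m)"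
      unfolding Y[OF m] q[OF m] by (simp only: algebra_simps) simp
  qed
  also have "\<dots> = (1 + q ^ (2 * n + 5)) * (\<Sum>m\<le>Suc n. g m * d (Suc n) m)
       - (\<Sum>m\<le>Suc n. (1 - q ^ (Suc n - m)) * (1 - q ^ (Suc n + m + 3)) * (g m * d (Suc n) m))"
    unfolding sum_subtractf sum_distrib_left ..
  also have "(\<Sum>m\<le>Suc n. (1 - q ^ (Suc n - m)) * (1 - q ^ (Suc n + m + 3)) * (g m * d (Suc n) m)) = (\<Sum>m\<le>n. g m * d n m)"
    by (simp add: d mult_ac)
  finally show ?thesis
    by (simp add: bsum_def d_def)
qed

text \<open>Abel summation: the part of \<open>\<alpha> (Suc j)\<close> containing
  \<open>g j\<close> is moved to index \<open>j\<close>, and both parts are put over the denominator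
  of \<open>bsum\<close>. The pairs use \<open>a = 1\<close>, \<open>b m = q ^ (2 * m + 3)\<close>
  in (i) and \<open>a m = b m = q ^ m\<close> in (ii). The prefactor converts \<open>(q^3;q)\<close>
  into \<open>(q;q)\<close>.\<close>

lemma bailey_sum:
  assumes "\<alpha> 0 = a 0 * g 0" "\<And>j. \<alpha> (Suc j) = a (Suc j) * g (Suc j) - b j * g j"
  shows "(\<Sum>j=0..n. \<alpha> j / (qpoch q q (n - j) * qpoch (q\<^sup>2 * q) q (n + j))) =
    (1 - q) * (1 - q\<^sup>2) * bsum (\<lambda>m. g m * (a m * (1 - q ^ (n + m + 3)) - b m * (1 - q ^ (n - m)))) n"
proof -
  define c where "c j = 1 / (qpoch q q (n - j) * qpoch q q (n + j + 2))" for j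
  define d where "d m = 1 / (qpoch q q (n - m) * qpoch q q (n + m + 3))" for m
  have c: "c m = (1 - q ^ (n + m + 3)) * d m" for m
  proof -
    have "c m = (1 / qpoch q q (n - m)) * (1 / qpoch q q (n + m + 3 - 1))"
      by (simp add: c_def)
    also have "\<dots> = (1 / qpoch q q (n - m)) * ((1 - q ^ (n + m + 3)) / qpoch q q (n + m + 3))"
      using inverse_qpoch_pred[of "n + m + 3"] by simp
    finally show ?thesis
      by (simp add: d_def)
  qed
  have c_Suc: "c (Suc m) = (1 - q ^ (n - m)) * d m" if "m < n" for m
  proof -
    have "c (Suc m) = (1 / qpoch q q (n - m - 1)) * (1 / qpoch q q (n + m + 3))"
      by (simp add: c_def numeral_3_eq_3)
    also have "\<dots> = (1 - q ^ (n - m)) / qpoch q q (n - m) * (1 / qpoch q q (n + m + 3))"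
      using that inverse_qpoch_pred[of "n - m"] by simp
    finally show ?thesis
      by (simp add: d_def)
  qed
  have "(\<Sum>j=0..n. \<alpha> j / (qpoch q q (n - j) * qpoch (q\<^sup>2 * q) q (n + j))) =
      (1 - q) * (1 - q\<^sup>2) * (\<Sum>j\<le>n. \<alpha> j * c j)"
    unfolding c_def sum_distrib_left atLeast0AtMost qpoch_q_add_2
    using q_power_neq_1[of 1] q_power_neq_1[of 2] by (intro sum.cong refl) simp
  also have "(\<Sum>j\<le>n. \<alpha> j * c j) = (\<Sum>j\<le>n. a j * g j * c j) - (\<Sum>j<n. b j * g j * c (Suc j))"
    unfolding sum.atMost_shift by (simp add: assms left_diff_distrib sum_subtractf)
  also have "(\<Sum>j<n. b j * g j * c (Suc j)) = (\<Sum>j<n. b j * g j * ((1 - q ^ (n - j)) * d j))"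
    by (intro sum.cong refl) (simp add: c_Suc)
  \<comment> \<open>The added term \<open>j = n\<close> is 0, as
    \<open>1 - q ^ (n - n) = 0\<close>.\<close>
  also have "\<dots> = (\<Sum>j\<le>n. b j * g j * ((1 - q ^ (n - j)) * d j))"
    by (simp flip: lessThan_Suc_atMost)
  also have "(\<Sum>j\<le>n. a j * g j * c j) - (\<Sum>j\<le>n. b j * g j * ((1 - q ^ (n - j)) * d j)) =
      bsum (\<lambda>m. g m * (a m * (1 - q ^ (n + m + 3)) - b m * (1 - q ^ (n - m)))) n"
    unfolding bsum_def sum_subtractf[symmetric] c
    by (intro sum.cong refl) (simp add: d_def algebra_simps diff_divide_distrib add_divide_distrib)
  finally show ?thesis .
qed

lemma bsum_wt_0: "bsum (\<lambda>m. wt m * (1 - q ^ (2 * m + 3)) * f m) 0 = f 0 * (qpoch (- (q\<^sup>2)) (q\<^sup>2) 0 / qpoch q q (2 * 0 + 2))"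
proof -
  have "bsum (\<lambda>m. wt m * (1 - q ^ (2 * m + 3)) * f m) 0 = f 0 * bsum (\<lambda>m. wt m * (1 - q ^ (2 * m + 3))) 0"
    by (simp add: bsum_def)
  then show ?thesis
    unfolding bsum_wt .
qed

text \<open>Solved for the quotient at \<open>n\<close>, so that both terms of the recursion in
  \<open>bsum_mult_Y_Suc\<close> become multiples of the quotient at \<open>Suc n\<close>.\<close>

lemma qpoch_quotient_step:
  "qpoch (- (q\<^sup>2)) (q\<^sup>2) n / qpoch q q (2 * n + 2) =
   qpoch (- (q\<^sup>2)) (q\<^sup>2) (Suc n) / qpoch q q (2 * Suc n + 2) * (1 - q ^ (2 * n + 3)) * (1 - q ^ (2 * n + 4)) / (1 + q ^ (2 * n + 2))"
proof -
  have "qpoch q q (2 * Suc n + 2) = qpoch q q (2 * n + 2) * (1 - q ^ (2 * n + 3)) * (1 - q ^ (2 * n + 4))"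
    by (simp add: qpoch_Suc eval_nat_numeral)
  moreover have "qpoch (- (q\<^sup>2)) (q\<^sup>2) (Suc n) = qpoch (- (q\<^sup>2)) (q\<^sup>2) n * (1 + q ^ (2 * n + 2))"
    by (simp only: qpoch_Suc power_add power_mult mult.commute[of "q\<^sup>2"] mult_minus_left diff_minus_eq_add)
  moreover have "1 - q ^ (2 * n + 3) \<noteq> 0" "1 - q ^ (2 * n + 4) \<noteq> 0" "1 + q ^ (2 * n + 2) \<noteq> 0"
    using q_power_neq_1[of "2 * n + 3"] q_power_neq_1[of "2 * n + 4"] one_plus_q_power_nonzero[of "2 * n + 2"]
    by (simp_all del: power_Suc)
  ultimately show ?thesis
    by (simp del: power_Suc)
qed

end

subsection \<open>Comparison with \<open>K\<close>\<close>

text \<open>Each \<open>u\<close>-dependent piece of \<open>K\<close> is a power of \<open>u\<close>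
  times an expression in \<open>A\<close>, and likewise for \<open>v\<close> and \<open>B\<close>;
  these powers cancel. The result is linear in \<open>A + B\<close> and \<open>A * B\<close>, ready
  for comparison with the expansion of \<open>(Y m - A) * (Y m - B)\<close>.\<close>

lemma K_times_normaliser:
  assumes "u \<noteq> 0" "v \<noteq> 0" "u \<noteq> 1" "v \<noteq> 1" "u \<noteq> a" "v \<noteq> a"
    and "a\<^sup>2 - b * c * d * e \<noteq> 0" "a\<^sup>2 - b * c * d * e * p \<noteq> 0"
  defines "A \<equiv> u + a / u" and "B \<equiv> v + a / v"
    and "\<sigma>1 \<equiv> b + c + d + e" and "\<sigma>2 \<equiv> b*c + b*d + b*e + c*d + c*e + d*e"
    and "\<sigma>3 \<equiv> b*c*d + b*c*e + b*d*e + c*d*e" and "\<sigma>4 \<equiv> b*c*d*e"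
  shows "K a b c d e u v p * ((1 + a - A) * (1 + a - B)) =
    (\<sigma>3 - a*\<sigma>1) * (p*\<sigma>3 - a*\<sigma>1) * a\<^sup>2 / ((a\<^sup>2 - \<sigma>4) * (a\<^sup>2 - \<sigma>4 * p))
    + (1 - p) * (a\<^sup>2 - \<sigma>2*a + \<sigma>4) * a / (a\<^sup>2 - \<sigma>4 * p)
    + (A + B) * ((\<sigma>3 - a*\<sigma>1) * a / (a\<^sup>2 - \<sigma>4)) + A * B"
proof -
  define D1 D2 where "D1 = a\<^sup>2 - \<sigma>4" and "D2 = a\<^sup>2 - \<sigma>4 * p"
  have D: "D1 \<noteq> 0" "D2 \<noteq> 0"
    using assms(7,8) by (simp_all add: D1_def D2_def \<sigma>4_def)
  have A: "u\<^sup>2 + a = u * A" and B: "v\<^sup>2 + a = v * B"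
    and AB: "(u + v) * (a + u * v) = u * v * (A + B)"
    using assms(1,2) by (simp_all add: A_def B_def field_simps power2_eq_square)
  have P: "(1 - u) * (a - u) = - u * (1 + a - A)" "(1 - v) * (a - v) = - v * (1 + a - B)"
    using assms(1,2) by (simp_all add: A_def B_def field_simps)
  have nz: "1 + a - A \<noteq> 0" "1 + a - B \<noteq> 0"
    using P assms(3-6) by auto
  define S where "S = \<sigma>3 - a * \<sigma>1"
  define R where "R = p * \<sigma>3 - a * \<sigma>1"
  define W where "W = a\<^sup>2 - \<sigma>2 * a + \<sigma>4"
  have "K a b c d e u v p = (u * v * S * R * a\<^sup>2 + (1 - p) * u * v * D1 * W * a
      + (u + v) * (a + u * v) * S * D2 * a + (u\<^sup>2 + a) * (v\<^sup>2 + a) * D1 * D2)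
      / (D1 * D2 * ((1 - u) * (a - u)) * ((1 - v) * (a - v)))"
    by (simp add: K_def Let_def S_def R_def W_def D1_def D2_def \<sigma>1_def \<sigma>2_def \<sigma>3_def \<sigma>4_def mult_ac)
  also have "\<dots> = (u * v * (S * R * a\<^sup>2 + (1 - p) * D1 * W * a + (A + B) * S * D2 * a + A * B * D1 * D2))
      / (u * v * (D1 * D2 * ((1 + a - A) * (1 + a - B))))"
    unfolding P A B AB by (simp add: algebra_simps)
  also have "\<dots> = (S * R * a\<^sup>2 + (1 - p) * D1 * W * a + (A + B) * S * D2 * a + A * B * D1 * D2)
      / (D1 * D2 * ((1 + a - A) * (1 + a - B)))"
    using assms(1,2) by simp
  finally have "K a b c d e u v p * ((1 + a - A) * (1 + a - B)) =
      (S * R * a\<^sup>2 + (1 - p) * D1 * W * a + (A + B) * S * D2 * a + A * B * D1 * D2) / (D1 * D2)"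
    using nz by simp
  also have "\<dots> = S * R * a\<^sup>2 / (D1 * D2) + (1 - p) * W * a / D2 + (A + B) * (S * a / D1) + A * B"
    using D by (simp add: add_divide_distrib)
  finally show ?thesis
    unfolding S_def R_def W_def D1_def D2_def .
qed

text \<open>Here \<open>x\<close> stands for \<open>q ^ n\<close>. The two conditions on
  \<open>x ^ 4\<close> keep the denominators of \<open>K\<close> away from 0; the second one rules
  out \<open>n = 1\<close>. The right-hand side has the form produced by applying the
  \<open>Y\<close>-recursion twice.\<close>

lemma K8_times_normaliser:
  fixes q x :: complex
  assumes "u \<noteq> 0" "v \<noteq> 0" "u \<noteq> 1" "v \<noteq> 1" "u \<noteq> q^3" "v \<noteq> q^3"
    and "q \<noteq> 0" "x \<noteq> 0" "x ^ 4 \<noteq> 1" "x ^ 4 \<noteq> q ^ 4"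
  defines "A \<equiv> u + q^3 / u" and "B \<equiv> v + q^3 / v" and "s \<equiv> 1 + q + q\<^sup>2 + q^3"
  shows "K (q^3) (1 / x) (q / x) (q\<^sup>2 / x) (q^3 / x) u v (q^4) * ((1 + q^3 - A) * (1 + q^3 - B)) =
    s / (1 + x\<^sup>2) * (1 + q^3 * x\<^sup>2 - q * (1 - q * x\<^sup>2) * (1 - q\<^sup>2 * x\<^sup>2) / (q\<^sup>2 + x\<^sup>2))
    - (A + B) * (s * x / (1 + x\<^sup>2)) + A * B"
proof -
  have f: "x ^ 4 - 1 = (x\<^sup>2 - 1) * (1 + x\<^sup>2)" "x ^ 4 - q ^ 4 = (x\<^sup>2 - q\<^sup>2) * (q\<^sup>2 + x\<^sup>2)"
    by (simp_all add: algebra_simps power2_eq_square power4_eq_xxxx)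
  have nz: "x\<^sup>2 - 1 \<noteq> 0" "1 + x\<^sup>2 \<noteq> 0" "x\<^sup>2 - q\<^sup>2 \<noteq> 0" "q\<^sup>2 + x\<^sup>2 \<noteq> 0"
    using f assms(9,10) by auto
  have s4: "1 / x * (q / x) * (q\<^sup>2 / x) * (q^3 / x) = q^6 / x^4"
    by (simp add: eval_nat_numeral mult.assoc)
  have s1: "1 / x + q / x + q\<^sup>2 / x + q^3 / x = s / x"
    by (simp add: s_def add_divide_distrib)
  have s3: "1 / x * (q / x) * (q\<^sup>2 / x) + 1 / x * (q / x) * (q^3 / x) + 1 / x * (q\<^sup>2 / x) * (q^3 / x) + q / x * (q\<^sup>2 / x) * (q^3 / x) = q^3 * s / x^3"
    using \<open>x \<noteq> 0\<close> by (simp add: s_def field_simps eval_nat_numeral)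
  have s2: "1 / x * (q / x) + 1 / x * (q\<^sup>2 / x) + 1 / x * (q^3 / x) + q / x * (q\<^sup>2 / x) + q / x * (q^3 / x) + q\<^sup>2 / x * (q^3 / x)
      = q * (1 + q + 2 * q\<^sup>2 + q^3 + q^4) / x\<^sup>2"
    using \<open>x \<noteq> 0\<close> by (simp add: field_simps eval_nat_numeral)
  have D1: "(q^3)\<^sup>2 - q^6 / x^4 = q^6 * ((x\<^sup>2 - 1) * (1 + x\<^sup>2)) / x^4"
    using \<open>x \<noteq> 0\<close> by (simp add: f(1)[symmetric] field_simps)
  have D2: "(q^3)\<^sup>2 - q^6 / x^4 * q^4 = q^6 * ((x\<^sup>2 - q\<^sup>2) * (q\<^sup>2 + x\<^sup>2)) / x^4"
    using \<open>x \<noteq> 0\<close> by (simp add: f(2)[symmetric] field_simps)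
  have S: "q^3 * s / x^3 - q^3 * (s / x) = - (q^3 * s * (x\<^sup>2 - 1)) / x^3"
    using \<open>x \<noteq> 0\<close> by (simp add: field_simps eval_nat_numeral)
  have 1: "(q^3 * s / x^3 - q^3 * (s / x)) * q^3 / ((q^3)\<^sup>2 - q^6 / x^4) = - (s * x / (1 + x\<^sup>2))"
    unfolding D1 S using nz assms(7,8) by (simp add: divide_simps) (simp add: eval_nat_numeral)
  have 2: "(q^3 * s / x^3 - q^3 * (s / x)) * (q^4 * (q^3 * s / x^3) - q^3 * (s / x)) * (q^3)\<^sup>2
      / (((q^3)\<^sup>2 - q^6 / x^4) * ((q^3)\<^sup>2 - q^6 / x^4 * q^4))
      = - (s\<^sup>2 * x\<^sup>2 * (q^4 - x\<^sup>2)) / ((1 + x\<^sup>2) * ((x\<^sup>2 - q\<^sup>2) * (q\<^sup>2 + x\<^sup>2)))"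
  proof -
    have "q^4 * (q^3 * s / x^3) - q^3 * (s / x) = q^3 * s * (q^4 - x\<^sup>2) / x^3"
      using \<open>x \<noteq> 0\<close> by (simp add: field_simps eval_nat_numeral)
    then show ?thesis
      unfolding D1 D2 S using nz assms(7,8) by (simp add: divide_simps) (simp add: eval_nat_numeral)
  qed
  have 3: "(1 - q^4) * ((q^3)\<^sup>2 - q * (1 + q + 2 * q\<^sup>2 + q^3 + q^4) / x\<^sup>2 * q^3 + q^6 / x^4) * q^3 / ((q^3)\<^sup>2 - q^6 / x^4 * q^4)
      = (1 - q^4) * (q^3 * x^4 - q * (1 + q + 2 * q\<^sup>2 + q^3 + q^4) * x\<^sup>2 + q^3) / ((x\<^sup>2 - q\<^sup>2) * (q\<^sup>2 + x\<^sup>2))"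
  proof -
    have "(q^3)\<^sup>2 - q * (1 + q + 2 * q\<^sup>2 + q^3 + q^4) / x\<^sup>2 * q^3 + q^6 / x^4 =
       q^3 * (q^3 * x^4 - q * (1 + q + 2 * q\<^sup>2 + q^3 + q^4) * x\<^sup>2 + q^3) / x^4"
      using \<open>x \<noteq> 0\<close> by (simp add: field_simps eval_nat_numeral)
    then show ?thesis
      unfolding D2 using nz assms(7,8) by (simp add: divide_simps) (simp add: eval_nat_numeral)
  qed
  have 4: "- (s\<^sup>2 * x\<^sup>2 * (q^4 - x\<^sup>2)) / ((1 + x\<^sup>2) * ((x\<^sup>2 - q\<^sup>2) * (q\<^sup>2 + x\<^sup>2))) +
     (1 - q^4) * (q^3 * x^4 - q * (1 + q + 2 * q\<^sup>2 + q^3 + q^4) * x\<^sup>2 + q^3) / ((x\<^sup>2 - q\<^sup>2) * (q\<^sup>2 + x\<^sup>2)) =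
     s / (1 + x\<^sup>2) * (1 + q^3 * x\<^sup>2 - q * (1 - q * x\<^sup>2) * (1 - q\<^sup>2 * x\<^sup>2) / (q\<^sup>2 + x\<^sup>2))" (is "?l = ?r")
  proof -
    have "?l = (- (s\<^sup>2 * x\<^sup>2 * (q^4 - x\<^sup>2)) + (1 - q^4) * (q^3 * x^4 - q * (1 + q + 2 * q\<^sup>2 + q^3 + q^4) * x\<^sup>2 + q^3) * (1 + x\<^sup>2))
       / ((1 + x\<^sup>2) * ((x\<^sup>2 - q\<^sup>2) * (q\<^sup>2 + x\<^sup>2)))"
      using nz by (simp add: divide_simps)
    \<comment> \<open>The factor \<open>x^2 - q^2\<close> of the denominator divides the numerator,
      leaving only the denominators that the \<open>Y\<close>-recursion creates.\<close>
    also have "- (s\<^sup>2 * x\<^sup>2 * (q^4 - x\<^sup>2)) + (1 - q^4) * (q^3 * x^4 - q * (1 + q + 2 * q\<^sup>2 + q^3 + q^4) * x\<^sup>2 + q^3) * (1 + x\<^sup>2) =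
       (s * ((1 + q^3 * x\<^sup>2) * (q\<^sup>2 + x\<^sup>2) - q * (1 - q * x\<^sup>2) * (1 - q\<^sup>2 * x\<^sup>2))) * (x\<^sup>2 - q\<^sup>2)"
      unfolding s_def by algebra
    also have "\<dots> / ((1 + x\<^sup>2) * ((x\<^sup>2 - q\<^sup>2) * (q\<^sup>2 + x\<^sup>2))) = ?r"
      using nz by (simp add: divide_simps)
    finally show ?thesis .
  qed
  have "K (q^3) (1 / x) (q / x) (q\<^sup>2 / x) (q^3 / x) u v (q^4) * ((1 + q^3 - A) * (1 + q^3 - B)) =
     - (s\<^sup>2 * x\<^sup>2 * (q^4 - x\<^sup>2)) / ((1 + x\<^sup>2) * ((x\<^sup>2 - q\<^sup>2) * (q\<^sup>2 + x\<^sup>2))) +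
     (1 - q^4) * (q^3 * x^4 - q * (1 + q + 2 * q\<^sup>2 + q^3 + q^4) * x\<^sup>2 + q^3) / ((x\<^sup>2 - q\<^sup>2) * (q\<^sup>2 + x\<^sup>2))
     + (A + B) * - (s * x / (1 + x\<^sup>2)) + A * B"
  proof -
    have "(q^3)\<^sup>2 - 1 / x * (q / x) * (q\<^sup>2 / x) * (q^3 / x) \<noteq> 0" "(q^3)\<^sup>2 - 1 / x * (q / x) * (q\<^sup>2 / x) * (q^3 / x) * q^4 \<noteq> 0"
      unfolding s4 D1 D2 using nz assms(7,8) by simp_all
    from K_times_normaliser[OF assms(1-6) this] show ?thesis
      unfolding s1 s2 s3 s4 1 2 3 A_def B_def .
  qed
  then show ?thesis
    unfolding 4 by simp
qed

section \<open>First and second moments of the weight in \<open>Y\<close>\<close>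

context q_generic
begin

lemma bsum_wt_Y_Suc:
  fixes n :: nat
  defines "x \<equiv> q ^ Suc n"
  shows "bsum (\<lambda>m. wt m * (1 - q ^ (2 * m + 3)) * Y m) (Suc n) =
    (1 + q + q\<^sup>2 + q^3) * x / (1 + x\<^sup>2) * (qpoch (- (q\<^sup>2)) (q\<^sup>2) (Suc n) / qpoch q q (2 * Suc n + 2))"
proof -
  define t where "t = qpoch (- (q\<^sup>2)) (q\<^sup>2) (Suc n) / qpoch q q (2 * Suc n + 2)"
  have x2: "q ^ (2 * n + 2) = x\<^sup>2"
    unfolding x_def power_mult[symmetric] by (simp add: mult.commute)
  have x: "q ^ (2 * n + 3) = q * x\<^sup>2" "q ^ (2 * n + 4) = q\<^sup>2 * x\<^sup>2" "q ^ (2 * n + 5) = q ^ 3 * x\<^sup>2"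
    using power_split[of "2 * n + 3" 1 "2 * n + 2" q] power_split[of "2 * n + 4" 2 "2 * n + 2" q]
      power_split[of "2 * n + 5" 3 "2 * n + 2" q]
    unfolding x2 by simp_all
  have nz: "x \<noteq> 0" "1 + x\<^sup>2 \<noteq> 0"
    using q_nonzero one_plus_q_power_nonzero[of "2 * n + 2"] by (simp add: x_def, simp only: x2 not_False_eq_True)
  have "x * bsum (\<lambda>m. wt m * (1 - q ^ (2 * m + 3)) * Y m) (Suc n) =
      (1 + q ^ 3 * x\<^sup>2) * t - t * (1 - q * x\<^sup>2) * (1 - q\<^sup>2 * x\<^sup>2) / (1 + x\<^sup>2)"
    unfolding x_def bsum_mult_Y_Suc bsum_wt qpoch_quotient_step[of n]
    unfolding x_def[symmetric] t_def[symmetric] x2 x ..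
  \<comment> \<open>In \<open>(1 + q^3 * x^2) * (1 + x^2) - (1 - q * x^2) * (1 - q^2 * x^2)\<close>
    the constant and the \<open>x^4\<close> terms cancel, and
    \<open>(1 + q + q^2 + q^3) * x^2\<close> remains.\<close>
  also have "\<dots> = x * ((1 + q + q\<^sup>2 + q^3) * x / (1 + x\<^sup>2) * t)"
    using nz(2) by (simp add: divide_simps) algebra
  finally show ?thesis
    unfolding mult_left_cancel[OF nz(1)] t_def .
qed

lemma bsum_wt_YY_Suc_Suc:
  fixes n :: nat
  defines "x \<equiv> q ^ (n + 2)"
  shows "bsum (\<lambda>m. wt m * (1 - q ^ (2 * m + 3)) * Y m * Y m) (Suc (Suc n)) =
    (1 + q + q\<^sup>2 + q^3) / (1 + x\<^sup>2) * (1 + q^3 * x\<^sup>2 - q * (1 - q * x\<^sup>2) * (1 - q\<^sup>2 * x\<^sup>2) / (q\<^sup>2 + x\<^sup>2))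
      * (qpoch (- (q\<^sup>2)) (q\<^sup>2) (Suc (Suc n)) / qpoch q q (2 * Suc (Suc n) + 2))"
proof -
  define t where "t = qpoch (- (q\<^sup>2)) (q\<^sup>2) (Suc (Suc n)) / qpoch q q (2 * Suc (Suc n) + 2)"
  define s where "s = 1 + q + q\<^sup>2 + q^3"
  have x1: "q ^ Suc (Suc n) = x" "q ^ Suc n = x / q"
    using q_nonzero by (simp_all add: x_def)
  have x2: "q ^ (2 * Suc n + 2) = x\<^sup>2"
    unfolding x_def power_mult[symmetric] by (simp add: mult.commute)
  have x: "q ^ (2 * Suc n + 3) = q * x\<^sup>2" "q ^ (2 * Suc n + 4) = q\<^sup>2 * x\<^sup>2" "q ^ (2 * Suc n + 5) = q ^ 3 * x\<^sup>2"
    using power_split[of "2 * Suc n + 3" 1 "2 * Suc n + 2" q] power_split[of "2 * Suc n + 4" 2 "2 * Suc n + 2" q]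
      power_split[of "2 * Suc n + 5" 3 "2 * Suc n + 2" q]
    unfolding x2 by simp_all
  have nz: "x \<noteq> 0" "1 + x\<^sup>2 \<noteq> 0"
    using q_nonzero one_plus_q_power_nonzero[of "2 * Suc n + 2"] by (simp add: x_def, simp only: x2 not_False_eq_True)
  have nz': "q\<^sup>2 + x\<^sup>2 \<noteq> 0"
  proof -
    have "q\<^sup>2 + x\<^sup>2 = q\<^sup>2 * (1 + q ^ (Suc n * 2))"
      using q_nonzero x1(2) by (simp add: power_mult distrib_left power_divide del: power_Suc mult_Suc)
    then show ?thesis
      using q_nonzero one_plus_q_power_nonzero[of "Suc n * 2"] by (simp del: power_Suc mult_Suc)
  qed
  have "x * bsum (\<lambda>m. wt m * (1 - q ^ (2 * m + 3)) * Y m * Y m) (Suc (Suc n)) =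
      (1 + q ^ 3 * x\<^sup>2) * (s * x / (1 + x\<^sup>2) * t)
      - s * (x / q) / (1 + (x / q)\<^sup>2) * (t * (1 - q * x\<^sup>2) * (1 - q\<^sup>2 * x\<^sup>2) / (1 + x\<^sup>2))"
    unfolding x1(1)[symmetric] bsum_mult_Y_Suc bsum_wt_Y_Suc qpoch_quotient_step[of "Suc n"]
    unfolding x1 t_def[symmetric] s_def[symmetric] x2 x ..
  also have "s * (x / q) / (1 + (x / q)\<^sup>2) = s * x * q / (q\<^sup>2 + x\<^sup>2)"
    using nz' q_nonzero by (simp add: field_simps power2_eq_square)
  also have "(1 + q ^ 3 * x\<^sup>2) * (s * x / (1 + x\<^sup>2) * t)
      - s * x * q / (q\<^sup>2 + x\<^sup>2) * (t * (1 - q * x\<^sup>2) * (1 - q\<^sup>2 * x\<^sup>2) / (1 + x\<^sup>2)) =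
      x * (s / (1 + x\<^sup>2) * (1 + q^3 * x\<^sup>2 - q * (1 - q * x\<^sup>2) * (1 - q\<^sup>2 * x\<^sup>2) / (q\<^sup>2 + x\<^sup>2)) * t)"
    using nz nz' by (simp add: divide_simps) algebra
  finally show ?thesis
    unfolding mult_left_cancel[OF nz(1)] t_def s_def .
qed

text \<open>The recursion here reaches index 0, where the first moment comes from the single value
  \<open>Y 0 = 1 + q^3\<close> and does not follow the pattern of \<open>bsum_wt_Y_Suc\<close>. This
  matches the separate clause of \<open>K8\<close> at \<open>n = 1\<close>.\<close>

lemma bsum_wt_YY_1:
  "bsum (\<lambda>m. wt m * (1 - q ^ (2 * m + 3)) * Y m * Y m) 1 =
    ((1 + q^5) * (1 + q) - (1 - q^6) * (1 - q\<^sup>2) / q) * (qpoch (- (q\<^sup>2)) (q\<^sup>2) 1 / qpoch q q (2 * 1 + 2))"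
proof -
  define t where "t = qpoch (- (q\<^sup>2)) (q\<^sup>2) 1 / qpoch q q (2 * 1 + 2)"
  have nz: "1 + q\<^sup>2 \<noteq> 0"
    by (rule one_plus_q_power_nonzero)
  have Y0: "Y 0 = 1 + q ^ 3"
    by (simp add: Y_def)
  have step: "qpoch (- (q\<^sup>2)) (q\<^sup>2) 0 / qpoch q q (2 * 0 + 2) = t * (1 - q ^ 3) * (1 - q ^ 4) / (1 + q\<^sup>2)"
    using qpoch_quotient_step[of 0] unfolding t_def One_nat_def[symmetric] by (simp only: mult_0_right add_0)
  have "q * bsum (\<lambda>m. wt m * (1 - q ^ (2 * m + 3)) * Y m * Y m) 1 =
    (1 + q ^ 5) * ((1 + q + q\<^sup>2 + q^3) * q / (1 + q\<^sup>2) * t) - (1 + q ^ 3) * (t * (1 - q ^ 3) * (1 - q ^ 4) / (1 + q\<^sup>2))"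
    using bsum_mult_Y_Suc[of 0 "\<lambda>m. wt m * (1 - q ^ (2 * m + 3)) * Y m"]
    unfolding bsum_wt_Y_Suc bsum_wt_0 step Y0
    unfolding t_def One_nat_def[symmetric] by (simp only: power_one_right mult_0_right add_0)
  also have "\<dots> = q * (((1 + q^5) * (1 + q) - (1 - q^6) * (1 - q\<^sup>2) / q) * t)"
  proof -
    have factors: "(1 + q + q\<^sup>2 + q^3) = (1 + q) * (1 + q\<^sup>2)" "1 - q ^ 4 = (1 - q\<^sup>2) * (1 + q\<^sup>2)" "1 - q ^ 6 = (1 + q^3) * (1 - q^3)"
      by (simp_all add: algebra_simps eval_nat_numeral)
    have "(1 + a) * ((1 + q) * m * q / m * t) - c * (t * d * (e * m) / m) =
        q * (((1 + a) * (1 + q) - c * d * e / q) * t)" if "m \<noteq> 0" for a c d e m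
      using that q_nonzero by (simp add: field_simps)
    from this[OF nz] show ?thesis
      unfolding factors .
  qed
  finally show ?thesis
    unfolding mult_left_cancel[OF q_nonzero] t_def .
qed

text \<open>Expanding \<open>(Y m - A) * (Y m - B)\<close> reduces the sum to the moments of order
  0, 1 and 2. They are the coefficients of \<open>A * B\<close>, \<open>-(A + B)\<close> and 1 in
  the normalised \<open>K8\<close>, up to the common quotient \<open>t n\<close>.\<close>

lemma bsum_wt_K8:
  fixes u v :: complex
  assumes uv: "u \<noteq> 0" "v \<noteq> 0" "u \<noteq> 1" "v \<noteq> 1" "u \<noteq> q^3" "v \<noteq> q^3"
  defines "A \<equiv> u + q^3 / u" and "B \<equiv> v + q^3 / v"
  shows "bsum (\<lambda>m. wt m * (1 - q ^ (2 * m + 3)) * ((Y m - A) * (Y m - B))) n =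
    (1 + q^3 - A) * (1 + q^3 - B) * K8 u v q n * (qpoch (- (q\<^sup>2)) (q\<^sup>2) n / qpoch q q (2 * n + 2))"
proof -
  define t where "t n = qpoch (- (q\<^sup>2)) (q\<^sup>2) n / qpoch q q (2 * n + 2)" for n
  define w where "w m = wt m * (1 - q ^ (2 * m + 3))" for m
  have lin: "bsum (\<lambda>m. w m * ((Y m - A) * (Y m - B))) n =
      bsum (\<lambda>m. w m * Y m * Y m) n - (A + B) * bsum (\<lambda>m. w m * Y m) n + A * B * bsum w n" for n
    unfolding bsum_def sum_distrib_left sum_subtractf[symmetric] sum.distrib[symmetric]
    by (intro sum.cong refl) (simp add: algebra_simps add_divide_distrib diff_divide_distrib)
  consider "n = 0" | "n = 1" | k where "n = Suc (Suc k)"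
    by (metis One_nat_def not0_implies_Suc)
  then have "bsum (\<lambda>m. w m * ((Y m - A) * (Y m - B))) n = (1 + q^3 - A) * (1 + q^3 - B) * K8 u v q n * t n"
  proof cases
    case 1
    then show ?thesis
      unfolding w_def t_def using bsum_wt_0[of "\<lambda>m. (Y m - A) * (Y m - B)"] by (simp add: K8_def Y_def)
  next
    case 2
    have P: "(u - 1) * (q^3 - u) = u * (1 + q^3 - A)" "(v - 1) * (q^3 - v) = v * (1 + q^3 - B)"
      "(q - u) * (q\<^sup>2 - u) = u * (A - q - q\<^sup>2)" "(q - v) * (q\<^sup>2 - v) = v * (B - q - q\<^sup>2)"
      using uv(1,2) by (simp_all add: A_def B_def field_simps eval_nat_numeral)
    have nz: "1 + q^3 - A \<noteq> 0" "1 + q^3 - B \<noteq> 0"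
      using P(1,2) uv by auto
    define Z where "Z = (q - 1)^4 * (q + 1)^2 * (q^2 + q + 1)"
    have "K8 u v q 1 = ((q - u) * (q\<^sup>2 - u)) * ((q - v) * (q\<^sup>2 - v)) / (((u - 1) * (q^3 - u)) * ((v - 1) * (q^3 - v)))
       - Z * u * v / (q * (((u - 1) * (q^3 - u)) * ((v - 1) * (q^3 - v))))"
      by (simp add: K8_def Z_def mult_ac)
    \<comment> \<open>In units of \<open>t 1\<close>, this form predicts the first moment
      \<open>q + q^2\<close> and the second moment \<open>(q + q^2)^2 - Z / q\<close>.\<close>
    then have K: "(1 + q^3 - A) * (1 + q^3 - B) * K8 u v q 1 = (A - q - q\<^sup>2) * (B - q - q\<^sup>2) - Z / q"
      unfolding P using nz uv(1,2) q_nonzero by (simp add: divide_simps) (simp add: mult_ac)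
    have T1: "bsum (\<lambda>m. w m * Y m) 1 = (q + q\<^sup>2) * t 1"
    proof -
      have "q + q\<^sup>2 = (1 + q + q\<^sup>2 + q^3) * q ^ Suc 0 / (1 + (q ^ Suc 0)\<^sup>2)"
        using one_plus_q_power_nonzero[of 2] by (simp add: nonzero_eq_divide_eq) (simp add: algebra_simps eval_nat_numeral)
      then show ?thesis
        unfolding w_def t_def One_nat_def by (simp only: bsum_wt_Y_Suc)
    qed
    have "(1 + q^5) * (1 + q) - (1 - q^6) * (1 - q\<^sup>2) / q = (q + q\<^sup>2)\<^sup>2 - Z / q"
      using q_nonzero by (simp add: divide_simps Z_def) algebra
    then have T2: "bsum (\<lambda>m. w m * Y m * Y m) 1 = ((q + q\<^sup>2)\<^sup>2 - Z / q) * t 1"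
      using bsum_wt_YY_1 unfolding w_def t_def by (simp only:)
    have T0: "bsum w 1 = t 1"
      unfolding w_def t_def by (rule bsum_wt)
    show ?thesis
      unfolding 2 lin K T0 T1 T2 by (simp add: algebra_simps power2_eq_square)
  next
    case (3 k)
    define x where "x = q ^ (k + 2)"
    have x: "x \<noteq> 0" "x ^ 4 \<noteq> 1" "x ^ 4 \<noteq> q ^ 4"
    proof -
      show "x \<noteq> 0"
        using q_nonzero by (simp add: x_def)
      have "x ^ 4 = q ^ (4 * k + 8)"
        unfolding x_def power_mult[symmetric] by (simp add: algebra_simps)
      then show "x ^ 4 \<noteq> 1"
        using q_power_neq_1[of "4 * k + 8"] by simp
      have "x ^ 4 = q ^ (4 * k + 4) * q ^ 4"
        unfolding \<open>x ^ 4 = _\<close> by (rule power_split) simp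
      then show "x ^ 4 \<noteq> q ^ 4"
        using q_power_neq_1[of "4 * k + 4"] q_nonzero by simp
    qed
    have powi: "q powi (i - int (Suc (Suc k))) = q powi i / x" for i
      using q_nonzero by (simp add: power_int_diff power_int_add x_def power_int_of_nat[symmetric] del: power_int_of_nat of_nat_Suc)
    have "K8 u v q n = K (q^3) (1 / x) (q / x) (q\<^sup>2 / x) (q^3 / x) u v (q^4)"
      using powi[of 0] powi[of 1] powi[of 2] powi[of 3] unfolding 3 K8_def by simp
    then have K: "(1 + q^3 - A) * (1 + q^3 - B) * K8 u v q n =
       (1 + q + q\<^sup>2 + q^3) / (1 + x\<^sup>2) * (1 + q^3 * x\<^sup>2 - q * (1 - q * x\<^sup>2) * (1 - q\<^sup>2 * x\<^sup>2) / (q\<^sup>2 + x\<^sup>2))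
       - (A + B) * ((1 + q + q\<^sup>2 + q^3) * x / (1 + x\<^sup>2)) + A * B"
      using K8_times_normaliser[OF uv q_nonzero x] unfolding A_def B_def by (simp only: mult.commute[of _ "K _ _ _ _ _ _ _ _"])
    have T2: "bsum (\<lambda>m. w m * Y m * Y m) n =
       (1 + q + q\<^sup>2 + q^3) / (1 + x\<^sup>2) * (1 + q^3 * x\<^sup>2 - q * (1 - q * x\<^sup>2) * (1 - q\<^sup>2 * x\<^sup>2) / (q\<^sup>2 + x\<^sup>2)) * t n"
      unfolding 3 w_def t_def x_def by (rule bsum_wt_YY_Suc_Suc)
    have "q ^ Suc (Suc k) = x"
      by (simp add: x_def)
    then have T1: "bsum (\<lambda>m. w m * Y m) n = (1 + q + q\<^sup>2 + q^3) * x / (1 + x\<^sup>2) * t n"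
      using bsum_wt_Y_Suc[of "Suc k"] unfolding 3 w_def t_def by (simp only:)
    have T0: "bsum w n = t n"
      unfolding w_def t_def by (rule bsum_wt)
    show ?thesis
      unfolding K lin T0 T1 T2 by (simp only: distrib_right left_diff_distrib mult.assoc)
  qed
  then show ?thesis
    unfolding w_def t_def .
qed

subsection \<open>The sequences \<open>L\<close> and \<open>M\<close>\<close>

lemma wt_values:
  "wt (4 * r) = q ^ (8 * r\<^sup>2 + 2 * r)" "wt (4 * r + 1) = - (q ^ (8 * r\<^sup>2 + 6 * r + 1))"
  "wt (4 * r + 2) = 0" "wt (4 * r + 3) = 0"
proof -
  have "(Suc (4 * r) choose 2) = 8 * r\<^sup>2 + 2 * r"
    using two_mult_choose_two[of "4 * r"] by (simp add: power2_eq_square)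
  then show "wt (4 * r) = q ^ (8 * r\<^sup>2 + 2 * r)"
    by (simp add: wt_def chi_def)
  have "(Suc (4 * r + 1) choose 2) = 8 * r\<^sup>2 + 6 * r + 1"
    using two_mult_choose_two[of "4 * r + 1"] by (simp add: power2_eq_square)
  moreover have "chi (4 * r + 1) = - 1"
    by (simp only: chi_add_4_mult) (simp add: chi_def)
  ultimately show "wt (4 * r + 1) = - (q ^ (8 * r\<^sup>2 + 6 * r + 1))"
    by (simp only: wt_def) simp
  show "wt (4 * r + 2) = 0" "wt (4 * r + 3) = 0"
    unfolding wt_def by (simp_all only: chi_add_4_mult) (simp_all add: chi_def)
qed

definition F :: "complex \<Rightarrow> complex \<Rightarrow> nat \<Rightarrow> complex" where
  "F u v m = (Y m - (u + q^3 / u)) * (Y m - (v + q^3 / v)) / ((1 + q^3 - (u + q^3 / u)) * (1 + q^3 - (v + q^3 / v)))"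

text \<open>After telescoping, the factors of \<open>u\<close> and \<open>q^3 / u\<close> combine:
  with \<open>X = q ^ (4 * r)\<close>, \<open>(1 - u * X) * (1 - q^3 / u * X)\<close> is
  \<open>X * (Y (4 * r) - A)\<close> for \<open>A = u + q^3 / u\<close>. The denominator is the same
  expression at \<open>X = 1\<close>.\<close>

lemma L_eq_F:
  assumes "u \<noteq> 0" "v \<noteq> 0" "u \<noteq> 1" "v \<noteq> 1" "u \<noteq> q^3" "v \<noteq> q^3"
    and "qpochs [u, v, q^3 / u, q^3 / v] (q^4) r \<noteq> 0"
  shows "L u v q r = q ^ (8 * r) * F u v (4 * r)"
proof -
  define X where "X = (q^4) ^ r"
  have X: "X \<noteq> 0" "q ^ (4 * r) = X" "q ^ (8 * r) = X * X" "Y (4 * r) = 1 / X + q^3 * X"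
  proof -
    show "X \<noteq> 0"
      using q_nonzero by (simp add: X_def)
    show *: "q ^ (4 * r) = X"
      by (simp add: X_def power_mult)
    show "q ^ (8 * r) = X * X"
      unfolding *[symmetric] by (rule power_split) simp
    show "Y (4 * r) = 1 / X + q^3 * X"
      by (simp add: Y_def power_add *)
  qed
  have quot: "(1 - u * X) / (1 - u) * ((1 - q^3 / u * X) / (1 - q^3 / u)) =
      X * ((Y (4 * r) - (u + q^3 / u)) / (1 + q^3 - (u + q^3 / u)))" if "u \<noteq> 0" for u
  proof -
    have "(1 - u * x) * (1 - q^3 / u * x) = x * (1 / x + q^3 * x - (u + q^3 / u))" if "x \<noteq> 0" for x
      using that \<open>u \<noteq> 0\<close> by (simp add: field_simps)
    from this[OF X(1)] this[of 1] show ?thesis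
      by (simp add: X(4))
  qed
  have "qpoch u (q^4) r \<noteq> 0" "qpoch v (q^4) r \<noteq> 0" "qpoch (q^3 / u) (q^4) r \<noteq> 0" "qpoch (q^3 / v) (q^4) r \<noteq> 0"
    using assms(7) by (auto simp: qpochs_def)
  moreover have "q^3 / u \<noteq> 1" "q^3 / v \<noteq> 1"
    using assms by auto
  moreover have "L u v q r = (qpoch (u * q^4) (q^4) r / qpoch u (q^4) r * (qpoch (q^3 / u * q^4) (q^4) r / qpoch (q^3 / u) (q^4) r))
      * (qpoch (v * q^4) (q^4) r / qpoch v (q^4) r * (qpoch (q^3 / v * q^4) (q^4) r / qpoch (q^3 / v) (q^4) r))"
  proof -
    have "q^7 / w = q^3 / w * q^4" for w
      by (simp flip: power_add)
    then show ?thesis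
      by (simp add: L_def qpochs_def mult_ac)
  qed
  ultimately have "L u v q r = ((1 - u * X) / (1 - u) * ((1 - q^3 / u * X) / (1 - q^3 / u))) *
      ((1 - v * X) / (1 - v) * ((1 - q^3 / v * X) / (1 - q^3 / v)))"
    using assms(3,4) by (simp only: qpoch_ratio X_def simp_thms)
  then show ?thesis
    unfolding quot[OF assms(1)] quot[OF assms(2)] X(3) F_def by simp
qed

text \<open>As for \<open>L\<close>, now pairing \<open>1 / u\<close> with \<open>u / q^3\<close>
  and with \<open>X = q ^ (4 * r + 4)\<close>. The product is
  \<open>X * (q^3 / X + X - A) / q^3\<close>, where \<open>q^3 / X + X\<close> is
  \<open>Y (4 * r + 1)\<close>; the division by \<open>q^3\<close> cancels against the
  denominator.\<close>

lemma M_eq_F: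
  assumes "u \<noteq> 0" "v \<noteq> 0" "u \<noteq> 1" "v \<noteq> 1" "u \<noteq> q^3" "v \<noteq> q^3"
    and "qpochs [1 / u, 1 / v, u / q^3, v / q^3] (q^4) (r + 1) \<noteq> 0"
  shows "M u v q (r + 1) = q ^ (8 * r + 8) * F u v (4 * r + 1)"
proof -
  define X where "X = (q^4) ^ (r + 1)"
  have X: "X \<noteq> 0" "q ^ (8 * r + 8) = X * X" "Y (4 * r + 1) = q^3 / X + X"
  proof -
    show "X \<noteq> 0"
      using q_nonzero by (simp add: X_def)
    have *: "X = q ^ (4 * r + 4)"
      unfolding X_def power_mult[symmetric] by (rule arg_cong[where f = "(^) q"]) simp
    show "q ^ (8 * r + 8) = X * X"
      unfolding * by (rule power_split) simp
    have "X = q ^ (4 * r + 1) * q ^ 3"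
      unfolding * by (rule power_split) simp
    then have "q^3 / X = 1 / q ^ (4 * r + 1)"
      using q_nonzero by simp
    moreover have "X = q ^ (4 * r + 1 + 3)"
      unfolding * by (rule arg_cong[where f = "(^) q"]) simp
    ultimately show "Y (4 * r + 1) = q^3 / X + X"
      unfolding Y_def by (simp only:)
  qed
  have quot: "(1 - 1 / u * X) / (1 - 1 / u) * ((1 - u / q^3 * X) / (1 - u / q^3)) =
      X * ((Y (4 * r + 1) - (u + q^3 / u)) / (1 + q^3 - (u + q^3 / u)))" if "u \<noteq> 0" for u
  proof -
    have "(1 - 1 / u * x) * (1 - u / q^3 * x) = x * (q^3 / x + x - (u + q^3 / u)) / q^3" if "x \<noteq> 0" for x
      using that \<open>u \<noteq> 0\<close> q_nonzero by (simp add: field_simps)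
    note numerator = this[OF X(1)]
    have denominator: "(1 - 1 / u) * (1 - u / q^3) = (1 + q^3 - (u + q^3 / u)) / q^3"
      using that q_nonzero by (simp add: field_simps)
    show ?thesis
      unfolding times_divide_times_eq numerator denominator X(3) using q_nonzero by simp
  qed
  have "qpoch (1 / u) (q^4) (r + 1) \<noteq> 0" "qpoch (1 / v) (q^4) (r + 1) \<noteq> 0"
    "qpoch (u / q^3) (q^4) (r + 1) \<noteq> 0" "qpoch (v / q^3) (q^4) (r + 1) \<noteq> 0"
    using assms(7) by (auto simp: qpochs_def)
  moreover have "u / q^3 \<noteq> 1" "v / q^3 \<noteq> 1" "1 / u \<noteq> 1" "1 / v \<noteq> 1"
    using assms q_nonzero by auto
  moreover have "M u v q (r + 1) =
      (qpoch (1 / u * q^4) (q^4) (r + 1) / qpoch (1 / u) (q^4) (r + 1) * (qpoch (u / q^3 * q^4) (q^4) (r + 1) / qpoch (u / q^3) (q^4) (r + 1)))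
      * (qpoch (1 / v * q^4) (q^4) (r + 1) / qpoch (1 / v) (q^4) (r + 1) * (qpoch (v / q^3 * q^4) (q^4) (r + 1) / qpoch (v / q^3) (q^4) (r + 1)))"
  proof -
    have "q * w = w / q^3 * q^4" "q^4 / w = 1 / w * q^4" for w
      using q_nonzero by (simp_all add: eval_nat_numeral)
    then show ?thesis
      by (simp only: M_def qpochs_def list.map prod_list.Cons prod_list.Nil mult_1_right) (simp add: mult_ac)
  qed
  ultimately have "M u v q (r + 1) = ((1 - 1 / u * X) / (1 - 1 / u) * ((1 - u / q^3 * X) / (1 - u / q^3))) *
      ((1 - 1 / v * X) / (1 - 1 / v) * ((1 - v / q^3 * X) / (1 - v / q^3)))"
    by (simp only: qpoch_ratio X_def simp_thms)
  then show ?thesis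
    unfolding quot[OF assms(1)] quot[OF assms(2)] X(2) F_def by simp
qed

text \<open>The common evaluation behind both Bailey pairs: the normaliser in \<open>F\<close>
  cancels the one in \<open>bsum_wt_K8\<close>, and the prefactor turns \<open>(q;q)\<close> into
  \<open>(q^3;q)\<close>.\<close>

lemma bsum_wt_F:
  assumes "u \<noteq> 0" "v \<noteq> 0" "u \<noteq> 1" "v \<noteq> 1" "u \<noteq> q^3" "v \<noteq> q^3"
  shows "(1 - q) * (1 - q\<^sup>2) * bsum (\<lambda>m. wt m * F u v m * (1 - q ^ (2 * m + 3))) n =
    K8 u v q n * (qpoch (- (q\<^sup>2)) (q\<^sup>2) n / qpoch (q^3) q (2 * n))"
proof -
  define A B where "A = u + q^3 / u" and "B = v + q^3 / v"
  have "(1 - u) * (q^3 - u) = - u * (1 + q^3 - A)" "(1 - v) * (q^3 - v) = - v * (1 + q^3 - B)"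
    using assms(1,2) by (simp_all add: A_def B_def field_simps)
  then have nz: "(1 + q^3 - A) * (1 + q^3 - B) \<noteq> 0"
    using assms by auto
  have "bsum (\<lambda>m. wt m * F u v m * (1 - q ^ (2 * m + 3))) n =
      1 / ((1 + q^3 - A) * (1 + q^3 - B)) * bsum (\<lambda>m. wt m * (1 - q ^ (2 * m + 3)) * ((Y m - A) * (Y m - B))) n"
    unfolding bsum_mult_left[symmetric] by (rule bsum_cong) (simp add: F_def A_def B_def mult_ac)
  also have "\<dots> = K8 u v q n * (qpoch (- (q\<^sup>2)) (q\<^sup>2) n / qpoch q q (2 * n + 2))"
    using nz bsum_wt_K8[OF assms] unfolding A_def B_def by simp
  also have "qpoch q q (2 * n + 2) = (1 - q) * (1 - q\<^sup>2) * qpoch (q^3) q (2 * n)"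
    using qpoch_q_add_2[of "2 * n"] by (simp add: eval_nat_numeral mult_ac)
  finally show ?thesis
    using q_power_neq_1[of 1] q_power_neq_1[of 2] by simp
qed

end

subsection \<open>The Bailey pairs\<close>

lemma all_mod_4_cases:
  fixes P :: "nat \<Rightarrow> bool"
  assumes "\<And>r. P (4 * r)" "\<And>r. P (4 * r + 1)" "\<And>r. P (4 * r + 2)" "\<And>r. P (4 * r + 3)"
  shows "P j"
proof -
  have "j = 4 * (j div 4) + j mod 4"
    by simp
  moreover have "j mod 4 = 0 \<or> j mod 4 = 1 \<or> j mod 4 = 2 \<or> j mod 4 = 3"
    by linarith
  ultimately show ?thesis
    using assms by (metis add.right_neutral)
qed

theorem theorem2p16:
  fixes u v q :: complex
  assumes "q \<noteq> 0" and "u \<noteq> 0" and "v \<noteq> 0"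
    and "\<And>n. qpoch q q n \<noteq> 0"
    and "\<And>r. qpochs [u, v, q^3 / u, q^3 / v] (q^4) r \<noteq> 0"
    and "\<And>r. qpochs [1 / u, 1 / v, u / q^3, v / q^3] (q^4) r \<noteq> 0"
  shows
    "(\<forall>\<alpha> \<beta> :: nat \<Rightarrow> complex.
        \<alpha> 0 = 1 \<and> \<beta> 0 = 1 \<and>
        (\<forall>r\<ge>1. \<alpha> (4*r - 1) = 0) \<and>
        (\<forall>r. \<alpha> (4*r) = L u v q r * q powi (8 * int r ^ 2 - 6 * int r)) \<and>
        (\<forall>r. \<alpha> (4*r + 1) = - L u v q r * q powi (8 * int r ^ 2 + 2 * int r + 3)
                            - M u v q (r + 1) * q powi (8 * int r ^ 2 - 2 * int r - 7)) \<and>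
        (\<forall>r\<ge>1. \<alpha> (4*r - 2) = M u v q r * q powi (8 * int r ^ 2 - 10 * int r)) \<and>
        (\<forall>n. \<beta> n = K8 u v q n * (qpoch (- (q^2)) (q^2) n / qpoch (q^3) q (2*n)))
        \<longrightarrow> bailey_pair q (q^2) \<alpha> \<beta>)
     \<and>
     (\<forall>\<alpha> \<beta> :: nat \<Rightarrow> complex.
        \<alpha> 0 = 1 \<and> \<beta> 0 = 1 \<and>
        (\<forall>r\<ge>1. \<alpha> (4*r - 1) = 0) \<and>
        (\<forall>r. \<alpha> (4*r) = L u v q r * q powi (8 * int r ^ 2 - 2 * int r)) \<and>
        (\<forall>r. \<alpha> (4*r + 1) = - L u v q r * q powi (8 * int r ^ 2 - 2 * int r)
                            - M u v q (r + 1) * q powi (8 * int r ^ 2 + 2 * int r - 6)) \<and>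
        (\<forall>r\<ge>1. \<alpha> (4*r - 2) = M u v q r * q powi (8 * int r ^ 2 - 14 * int r)) \<and>
        (\<forall>n. \<beta> n = K8 u v q n * q ^ n * (qpoch (- (q^2)) (q^2) n / qpoch (q^3) q (2*n)))
        \<longrightarrow> bailey_pair q (q^2) \<alpha> \<beta>)"
proof -
  interpret q_generic q
    using assms(1,4) by unfold_locales
  \<comment> \<open>The instance \<open>r = 1\<close> of the genericity assumption already separates
    \<open>u\<close> and \<open>v\<close> from 1 and \<open>q^3\<close>.\<close>
  have "1 - u \<noteq> 0" "1 - v \<noteq> 0" "1 - q^3 / u \<noteq> 0" "1 - q^3 / v \<noteq> 0"
    using assms(5)[of 1] by (auto simp: qpochs_def qpoch_Suc)
  then have uv: "u \<noteq> 0" "v \<noteq> 0" "u \<noteq> 1" "v \<noteq> 1" "u \<noteq> q^3" "v \<noteq> q^3"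
    using assms(1-3) by auto
  have L: "L u v q r * q powi e = F u v (4 * r) * q ^ k" if "e + int (8 * r) = int k" for r e k
    unfolding power_int_mult_power[OF assms(1) that, symmetric] L_eq_F[OF uv assms(5)] by (simp only: mult_ac)
  have M: "M u v q (r + 1) * q powi e = F u v (4 * r + 1) * q ^ k" if "e + int (8 * r + 8) = int k" for r e k
    unfolding power_int_mult_power[OF assms(1) that, symmetric] M_eq_F[OF uv assms(6)] by (simp only: mult_ac)
  define g where "g m = wt m * F u v m" for m
  have g: "g (4 * r) = F u v (4 * r) * q ^ (8 * r\<^sup>2 + 2 * r)"
    "g (4 * r + 1) = - (F u v (4 * r + 1) * q ^ (8 * r\<^sup>2 + 6 * r + 1))"
    "g (4 * r + 2) = 0" "g (4 * r + 3) = 0" for r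
    unfolding g_def wt_values by simp_all
  show ?thesis
  proof (intro conjI allI impI; elim conjE)
    fix \<alpha> \<beta> :: "nat \<Rightarrow> complex"
    assume \<alpha>0: "\<alpha> 0 = 1"
      and \<alpha>3: "\<forall>r\<ge>1. \<alpha> (4*r - 1) = 0"
      and \<alpha>4: "\<forall>r. \<alpha> (4*r) = L u v q r * q powi (8 * int r ^ 2 - 6 * int r)"
      and \<alpha>1: "\<forall>r. \<alpha> (4*r + 1) = - L u v q r * q powi (8 * int r ^ 2 + 2 * int r + 3)
                            - M u v q (r + 1) * q powi (8 * int r ^ 2 - 2 * int r - 7)"
      and \<alpha>2: "\<forall>r\<ge>1. \<alpha> (4*r - 2) = M u v q r * q powi (8 * int r ^ 2 - 10 * int r)"
      and \<beta>: "\<forall>n. \<beta> n = K8 u v q n * (qpoch (- (q^2)) (q^2) n / qpoch (q^3) q (2*n))"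
    have even: "\<alpha> (4 * r) = g (4 * r)" for r
      unfolding g using \<alpha>4 L[of "8 * int r ^ 2 - 6 * int r" r "8 * r\<^sup>2 + 2 * r"] by simp
    \<comment> \<open>As \<open>g\<close> vanishes at residues 2 and 3, both terms survive only for
      \<open>\<alpha> (4 * r + 1)\<close>: its \<open>L\<close> part comes from
      \<open>g (4 * r)\<close> and its \<open>M\<close> part from
      \<open>g (4 * r + 1)\<close>.\<close>
    have step: "\<alpha> (Suc j) = 1 * g (Suc j) - q ^ (2 * j + 3) * g j" for j
    proof (induction j rule: all_mod_4_cases)
      case (1 r)
      have "q ^ (8 * r\<^sup>2 + 10 * r + 3) = q ^ (2 * (4 * r) + 3) * q ^ (8 * r\<^sup>2 + 2 * r)"
        by (rule power_split) simp
      moreover have "\<alpha> (4 * r + 1) = - (F u v (4 * r) * q ^ (8 * r\<^sup>2 + 10 * r + 3)) - F u v (4 * r + 1) * q ^ (8 * r\<^sup>2 + 6 * r + 1)"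
        using \<alpha>1 L[of "8 * int r ^ 2 + 2 * int r + 3" r "8 * r\<^sup>2 + 10 * r + 3"]
          M[of "8 * int r ^ 2 - 2 * int r - 7" r "8 * r\<^sup>2 + 6 * r + 1"] by simp
      ultimately show ?case
        unfolding Suc_eq_plus1 g by simp
    next
      case (2 r)
      have "q ^ (8 * r\<^sup>2 + 14 * r + 6) = q ^ (2 * (4 * r + 1) + 3) * q ^ (8 * r\<^sup>2 + 6 * r + 1)"
        by (rule power_split) simp
      moreover have "\<alpha> (4 * (r + 1) - 2) = F u v (4 * r + 1) * q ^ (8 * r\<^sup>2 + 14 * r + 6)"
        using \<alpha>2[rule_format, of "r + 1"]
          M[of "8 * int (r + 1) ^ 2 - 10 * int (r + 1)" r "8 * r\<^sup>2 + 14 * r + 6"]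
        by (simp add: algebra_simps power2_eq_square)
      moreover have "4 * (r + 1) - 2 = 4 * r + 2" "Suc (4 * r + 1) = 4 * r + 2"
        by simp_all
      ultimately show ?case
        unfolding g by (simp only: g) simp
    next
      case (3 r)
      have "Suc (4 * r + 2) = 4 * r + 3" "4 * (r + 1) - 1 = 4 * r + 3"
        by simp_all
      then show ?case
        using \<alpha>3[rule_format, of "r + 1"] by (simp only: g) simp
    next
      case (4 r)
      have "Suc (4 * r + 3) = 4 * (r + 1)"
        by simp
      then show ?case
        using even[of "r + 1"] by (simp only: g(4)) simp
    qed
    show "bailey_pair q (q\<^sup>2) \<alpha> \<beta>"
      unfolding bailey_pair_def
    proof (intro conjI allI)
      fix n
      have "(\<Sum>j=0..n. \<alpha> j / (qpoch q q (n - j) * qpoch (q\<^sup>2 * q) q (n + j))) =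
          (1 - q) * (1 - q\<^sup>2) * bsum (\<lambda>m. g m * (1 * (1 - q ^ (n + m + 3)) - q ^ (2 * m + 3) * (1 - q ^ (n - m)))) n"
        using even[of 0] step by (intro bailey_sum[where a = "\<lambda>_. 1"]) simp_all
      \<comment> \<open>The terms with \<open>q ^ (n + m + 3)\<close> cancel, so the bracket no
        longer depends on \<open>n\<close>.\<close>
      also have "bsum (\<lambda>m. g m * (1 * (1 - q ^ (n + m + 3)) - q ^ (2 * m + 3) * (1 - q ^ (n - m)))) n =
          bsum (\<lambda>m. wt m * F u v m * (1 - q ^ (2 * m + 3))) n"
      proof (rule bsum_cong)
        fix m assume "m \<le> n"
        then have "q ^ (n + m + 3) = q ^ (2 * m + 3) * q ^ (n - m)"
          by (intro power_split) simp
        then show "g m * (1 * (1 - q ^ (n + m + 3)) - q ^ (2 * m + 3) * (1 - q ^ (n - m))) = wt m * F u v m * (1 - q ^ (2 * m + 3))"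
          by (simp add: g_def right_diff_distrib)
      qed
      finally show "\<beta> n = (\<Sum>j=0..n. \<alpha> j / (qpoch q q (n - j) * qpoch (q\<^sup>2 * q) q (n + j)))"
        using \<beta> bsum_wt_F[OF uv] by simp
    qed (rule \<alpha>0)
  next
    fix \<alpha> \<beta> :: "nat \<Rightarrow> complex"
    assume \<alpha>0: "\<alpha> 0 = 1"
      and \<alpha>3: "\<forall>r\<ge>1. \<alpha> (4*r - 1) = 0"
      and \<alpha>4: "\<forall>r. \<alpha> (4*r) = L u v q r * q powi (8 * int r ^ 2 - 2 * int r)"
      and \<alpha>1: "\<forall>r. \<alpha> (4*r + 1) = - L u v q r * q powi (8 * int r ^ 2 - 2 * int r)
                            - M u v q (r + 1) * q powi (8 * int r ^ 2 + 2 * int r - 6)"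
      and \<alpha>2: "\<forall>r\<ge>1. \<alpha> (4*r - 2) = M u v q r * q powi (8 * int r ^ 2 - 14 * int r)"
      and \<beta>: "\<forall>n. \<beta> n = K8 u v q n * q ^ n * (qpoch (- (q^2)) (q^2) n / qpoch (q^3) q (2*n))"
    have p4: "q ^ (8 * r\<^sup>2 + 6 * r) = q ^ (4 * r) * q ^ (8 * r\<^sup>2 + 2 * r)" for r
      by (rule power_split) simp
    have p1: "q ^ (8 * r\<^sup>2 + 10 * r + 2) = q ^ (4 * r + 1) * q ^ (8 * r\<^sup>2 + 6 * r + 1)" for r
      by (rule power_split) simp
    have even: "\<alpha> (4 * r) = q ^ (4 * r) * g (4 * r)" for r
      unfolding g using \<alpha>4 L[of "8 * int r ^ 2 - 2 * int r" r "8 * r\<^sup>2 + 6 * r"] by (simp add: p4)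
    have step: "\<alpha> (Suc j) = q ^ Suc j * g (Suc j) - q ^ j * g j" for j
    proof (induction j rule: all_mod_4_cases)
      case (1 r)
      have "\<alpha> (4 * r + 1) = - (F u v (4 * r) * q ^ (8 * r\<^sup>2 + 6 * r)) - F u v (4 * r + 1) * q ^ (8 * r\<^sup>2 + 10 * r + 2)"
        using \<alpha>1 L[of "8 * int r ^ 2 - 2 * int r" r "8 * r\<^sup>2 + 6 * r"]
          M[of "8 * int r ^ 2 + 2 * int r - 6" r "8 * r\<^sup>2 + 10 * r + 2"] by simp
      then show ?case
        unfolding Suc_eq_plus1 g p4 p1 by simp
    next
      case (2 r)
      have "\<alpha> (4 * (r + 1) - 2) = F u v (4 * r + 1) * q ^ (8 * r\<^sup>2 + 10 * r + 2)"
        using \<alpha>2[rule_format, of "r + 1"]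
          M[of "8 * int (r + 1) ^ 2 - 14 * int (r + 1)" r "8 * r\<^sup>2 + 10 * r + 2"]
        by (simp add: algebra_simps power2_eq_square)
      moreover have "4 * (r + 1) - 2 = 4 * r + 2" "Suc (4 * r + 1) = 4 * r + 2"
        by simp_all
      ultimately show ?case
        by (simp only: g p1) simp
    next
      case (3 r)
      have "Suc (4 * r + 2) = 4 * r + 3" "4 * (r + 1) - 1 = 4 * r + 3"
        by simp_all
      then show ?case
        using \<alpha>3[rule_format, of "r + 1"] by (simp only: g) simp
    next
      case (4 r)
      have "Suc (4 * r + 3) = 4 * (r + 1)"
        by simp
      then show ?case
        using even[of "r + 1"] by (simp only: g(4)) simp
    qed
    show "bailey_pair q (q\<^sup>2) \<alpha> \<beta>"
      unfolding bailey_pair_def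
    proof (intro conjI allI)
      fix n
      have "(\<Sum>j=0..n. \<alpha> j / (qpoch q q (n - j) * qpoch (q\<^sup>2 * q) q (n + j))) =
          (1 - q) * (1 - q\<^sup>2) * bsum (\<lambda>m. g m * (q ^ m * (1 - q ^ (n + m + 3)) - q ^ m * (1 - q ^ (n - m)))) n"
        using even[of 0] step by (intro bailey_sum) simp_all
      \<comment> \<open>Here the bracket is \<open>q ^ n - q ^ (n + 2 * m + 3)\<close>, which
        accounts for the extra \<open>q ^ n\<close> in the second \<open>\<beta>\<close>.\<close>
      also have "bsum (\<lambda>m. g m * (q ^ m * (1 - q ^ (n + m + 3)) - q ^ m * (1 - q ^ (n - m)))) n =
          q ^ n * bsum (\<lambda>m. wt m * F u v m * (1 - q ^ (2 * m + 3))) n"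
        unfolding bsum_mult_left[symmetric]
      proof (rule bsum_cong)
        fix m assume "m \<le> n"
        then have "q ^ (n + m + 3) = q ^ (n - m) * q ^ (2 * m + 3)" "q ^ n = q ^ m * q ^ (n - m)"
          by (auto intro!: power_split)
        then show "g m * (q ^ m * (1 - q ^ (n + m + 3)) - q ^ m * (1 - q ^ (n - m))) = q ^ n * (wt m * F u v m * (1 - q ^ (2 * m + 3)))"
          by (simp add: g_def algebra_simps)
      qed
      also have "(1 - q) * (1 - q\<^sup>2) * (q ^ n * b) = q ^ n * ((1 - q) * (1 - q\<^sup>2) * b)" for b
        by (simp only: mult_ac)
      finally show "\<beta> n = (\<Sum>j=0..n. \<alpha> j / (qpoch q q (n - j) * qpoch (q\<^sup>2 * q) q (n + j)))"
        using \<beta> unfolding bsum_wt_F[OF uv] by simp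
    qed (rule \<alpha>0)
  qed
qed

end
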